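(* Let $(\mathcal M_n)_{n\in\mathbb N}$ be a sequence of commutative von Neumann algebras, let $I,J$ be countable index sets, and for every $n\in\mathbb N$ let $R_n$, $S_n$, $\{\rho_{n,i}\}_{i\in I}$, $\{\sigma_{n,j}\}_{j\in J}$ be sets of states on $\mathcal M_n$. Let $\mathrm e$ be any of the error exponents $\mathrm s$ (Stein), $\mathrm c$ (Chernoff), or $\mathrm d_r$ with $r>0$ (direct). Then $$\mathrm e^{\{0\}}\big((\{\rho_{n,i}\}_{i\in I})_{n}\,\|\,(S_n)_{n}\big)=\inf_{i\in I}\mathrm e\big((\rho_{n,i})_{n}\,\|\,(S_n)_{n}\big),$$ $$\mathrm e^{\{1\}}\big((R_n)_{n}\,\|\,(\{\sigma_{n,j}\}_{j\in J})_{n}\big)=\inf_{j\in J}\mathrm e\big((R_n)_{n}\,\|\,(\sigma_{n,j})_{n}\big),$$ $$\mathrm e^{\{0,1\}}\big((\{\rho_{n,i}\}_{i\in I})_{n}\,\|\,(\{\sigma_{n,j}\}_{j\in J})_{n}\big)=\inf_{i\in I,\,j\in J}\mathrm e\big((\rho_{n,i})_{n}\,\|\,(\sigma_{n,j})_{n}\big).$$ Moreover, the exponents $\mathrm e^{\{0\}}$, $\mathrm e^{\{1\}}$, $\mathrm e^{\{0,1\}}$ on the left-hand sides coincide with $\mathrm e$ if $I$ is finite, $J$ is finite, or both $I$ and $J$ are finite, respectively.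
   Context: A state on a von Neumann algebra $\mathcal M$ is a normal positive linear functional $\rho$ with $\rho(I)=1$; a test is an operator $T\in\mathcal M$ with $0\le T\le I$. All sets of states and index sets are non-empty. $\log$ is the natural logarithm and $-\log 0=+\infty$. A binary state discrimination problem on $(\mathcal M_n)_n$ is given by two sequences of sets of states, $H_0:(R_n)_n$ and $H_1:(S_n)_n$. For a test $T_n\in\mathcal M_n$ the error probabilities are $\alpha_n(R_n|T_n)=\sup_{\rho\in R_n}\rho(I-T_n)$ and $\beta_n(S_n|T_n)=\sup_{\sigma\in S_n}\sigma(T_n)$. For a single state we write $\rho_n$ instead of $\{\rho_n\}$. Achievable pairs: $\mathbb A(H_0\|H_1)$ is the set of $(r,r')\in[0,+\infty]^2$ for which there is a sequence of tests $T_n\in\mathcal M_n$ with (a) $r\le\liminf_n-\frac1n\log\beta_n(S_n|T_n)$ and (b) $r'\le\liminf_n-\frac1n\log\alpha_n(R_n|T_n)$. Relaxed versions, for $t\subseteq\{0,1\}$: if $0\in t$, then $R_n=\{\rho_{n,i}\}_{i\in I}$ with $I$ independent of $n$, and (b) is replaced by: for every $i\in I$, $r'\le\liminf_n-\frac1n\log\rho_{n,i}(I-T_n)$. If $1\in t$, then $S_n=\{\sigma_{n,j}\}_{j\in J}$ with $J$ independent of $n$, and (a) is replaced by: for every $j\in J$, $r\le\liminf_n-\frac1n\log\sigma_{n,j}(T_n)$. The resulting set is $\mathbb A^t(H_0\|H_1)$, with $\mathbb A^{\emptyset}=\mathbb A$. Exponents: $\mathrm d_r^t(H_0\|H_1)=\sup\{r':(r,r')\in\mathbb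 A^t(H_0\|H_1)\}$ for $r>0$; $\mathrm c^t(H_0\|H_1)=\sup\{r:(r,r)\in\mathbb A^t(H_0\|H_1)\}$; $\mathrm s(H_0\|H_1)$ is the supremum of all $r\ge0$ for which there are tests $T_n$ with $\liminf_n-\frac1n\log\beta_n(S_n|T_n)\ge r$ and $\lim_n\alpha_n(R_n|T_n)=0$; in $\mathrm s^t$ the condition on $\alpha_n$ (if $0\in t$) is replaced by $\lim_n\rho_{n,i}(I-T_n)=0$ for every $i\in I$, and the condition on $\beta_n$ (if $1\in t$) is replaced by $\liminf_n-\frac1n\log\sigma_{n,j}(T_n)\ge r$ for every $j\in J$. For $t=\emptyset$ the superscript is omitted. *)

theory Defs
  imports "HOL-Analysis.Analysis"
begin

section \<open>Complex Hilbert spaces\<close>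

text \<open>The inner product is conjugate-linear in the first and linear in the second argument.\<close>

class complex_hilbert = banach +
  fixes scaleC :: "complex \<Rightarrow> 'a \<Rightarrow> 'a"  (infixr "*\<^sub>C" 75)
    and cinner :: "'a \<Rightarrow> 'a \<Rightarrow> complex"
  assumes scaleC_add_right: "a *\<^sub>C (x + y) = a *\<^sub>C x + a *\<^sub>C y"
    and scaleC_add_left: "(a + b) *\<^sub>C x = a *\<^sub>C x + b *\<^sub>C x"
    and scaleC_scaleC: "a *\<^sub>C b *\<^sub>C x = (a * b) *\<^sub>C x"
    and scaleR_scaleC: "r *\<^sub>R x = complex_of_real r *\<^sub>C x"
    and cinner_commute: "cinner x y = cnj (cinner y x)"
    and cinner_add_right: "cinner x (y + z) = cinner x y + cinner x z"
    and cinner_scaleC_right: "cinner x (a *\<^sub>C y) = a * cinner x y"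
    and cinner_norm: "cinner x x = complex_of_real ((norm x)\<^sup>2)"

instantiation complex :: complex_hilbert
begin

definition scaleC_complex :: "complex \<Rightarrow> complex \<Rightarrow> complex"
  where "scaleC_complex a x = a * x"

definition cinner_complex :: "complex \<Rightarrow> complex \<Rightarrow> complex"
  where "cinner_complex x y = cnj x * y"

instance
proof
  show "cinner x x = complex_of_real ((norm x)\<^sup>2)" for x :: complex
    by (metis cinner_complex_def complex_norm_square mult.commute)
qed (simp_all add: scaleC_complex_def cinner_complex_def algebra_simps scaleR_conv_of_real)

end

text \<open>
  The algebras of a sequence act on different Hilbert spaces.  These are modelled as closed
  subspaces of one ambient Hilbert space; any sequence of Hilbert spaces can be realised in
  this way inside its direct sum.
\<close>

definition closed_csubspace :: "'h::complex_hilbert set \<Rightarrow> bool" where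
  "closed_csubspace H \<longleftrightarrow>
     0 \<in> H \<and> (\<forall>x\<in>H. \<forall>y\<in>H. x + y \<in> H) \<and> (\<forall>c. \<forall>x\<in>H. c *\<^sub>C x \<in> H) \<and> closed H"


section \<open>Bounded operators on a Hilbert space\<close>

text \<open>
  An operator on \<open>H\<close> is an extensional function, so that equality of operators
  is equality of their values on \<open>H\<close>; the product of operators is \<^const>\<open>compose\<close>.
\<close>

definition bounded_ops :: "'h::complex_hilbert set \<Rightarrow> ('h \<Rightarrow> 'h) set" where
  "bounded_ops H = {A \<in> H \<rightarrow>\<^sub>E H.
     (\<forall>x\<in>H. \<forall>y\<in>H. A (x + y) = A x + A y) \<and>
     (\<forall>c. \<forall>x\<in>H. A (c *\<^sub>C x) = c *\<^sub>C A x) \<and>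
     (\<exists>b. \<forall>x\<in>H. norm (A x) \<le> b * norm x)}"

definition op_zero :: "'h::complex_hilbert set \<Rightarrow> 'h \<Rightarrow> 'h" where
  "op_zero H = (\<lambda>x\<in>H. 0)"

definition op_id :: "'h::complex_hilbert set \<Rightarrow> 'h \<Rightarrow> 'h" where
  "op_id H = (\<lambda>x\<in>H. x)"

definition op_add :: "'h::complex_hilbert set \<Rightarrow> ('h \<Rightarrow> 'h) \<Rightarrow> ('h \<Rightarrow> 'h) \<Rightarrow> 'h \<Rightarrow> 'h" where
  "op_add H A B = (\<lambda>x\<in>H. A x + B x)"

definition op_diff :: "'h::complex_hilbert set \<Rightarrow> ('h \<Rightarrow> 'h) \<Rightarrow> ('h \<Rightarrow> 'h) \<Rightarrow> 'h \<Rightarrow> 'h" where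
  "op_diff H A B = (\<lambda>x\<in>H. A x - B x)"

definition op_scale :: "'h::complex_hilbert set \<Rightarrow> complex \<Rightarrow> ('h \<Rightarrow> 'h) \<Rightarrow> 'h \<Rightarrow> 'h" where
  "op_scale H c A = (\<lambda>x\<in>H. c *\<^sub>C A x)"

definition is_adjoint :: "'h::complex_hilbert set \<Rightarrow> ('h \<Rightarrow> 'h) \<Rightarrow> ('h \<Rightarrow> 'h) \<Rightarrow> bool" where
  "is_adjoint H A B \<longleftrightarrow> (\<forall>x\<in>H. \<forall>y\<in>H. cinner (A x) y = cinner x (B y))"

definition pos_op :: "'h::complex_hilbert set \<Rightarrow> ('h \<Rightarrow> 'h) \<Rightarrow> bool" where
  "pos_op H A \<longleftrightarrow> (\<forall>x\<in>H. cinner x (A x) \<in> \<real>\<^sub>\<ge>\<^sub>0)"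

definition op_le :: "'h::complex_hilbert set \<Rightarrow> ('h \<Rightarrow> 'h) \<Rightarrow> ('h \<Rightarrow> 'h) \<Rightarrow> bool" where
  "op_le H A B \<longleftrightarrow> pos_op H (op_diff H B A)"


section \<open>Von Neumann algebras, normal states and tests\<close>

definition commutant :: "'h::complex_hilbert set \<Rightarrow> ('h \<Rightarrow> 'h) set \<Rightarrow> ('h \<Rightarrow> 'h) set" where
  "commutant H M = {A \<in> bounded_ops H. \<forall>B\<in>M. compose H A B = compose H B A}"

definition von_neumann_algebra :: "'h::complex_hilbert set \<Rightarrow> ('h \<Rightarrow> 'h) set \<Rightarrow> bool" where
  "von_neumann_algebra H M \<longleftrightarrow>
     closed_csubspace H \<and> M \<subseteq> bounded_ops H \<and>
     (\<forall>A\<in>M. \<exists>B\<in>M. is_adjoint H A B) \<and>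
     commutant H (commutant H M) = M"

definition commutative_vna :: "'h::complex_hilbert set \<Rightarrow> ('h \<Rightarrow> 'h) set \<Rightarrow> bool" where
  "commutative_vna H M \<longleftrightarrow>
     von_neumann_algebra H M \<and> (\<forall>A\<in>M. \<forall>B\<in>M. compose H A B = compose H B A)"

definition linear_functional ::
  "'h::complex_hilbert set \<Rightarrow> ('h \<Rightarrow> 'h) set \<Rightarrow> (('h \<Rightarrow> 'h) \<Rightarrow> complex) \<Rightarrow> bool" where
  "linear_functional H M \<phi> \<longleftrightarrow>
     \<phi> \<in> extensional M \<and>
     (\<forall>A\<in>M. \<forall>B\<in>M. \<phi> (op_add H A B) = \<phi> A + \<phi> B) \<and>
     (\<forall>c. \<forall>A\<in>M. \<phi> (op_scale H c A) = c * \<phi> A)"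

definition positive_functional ::
  "'h::complex_hilbert set \<Rightarrow> ('h \<Rightarrow> 'h) set \<Rightarrow> (('h \<Rightarrow> 'h) \<Rightarrow> complex) \<Rightarrow> bool" where
  "positive_functional H M \<phi> \<longleftrightarrow>
     linear_functional H M \<phi> \<and> (\<forall>A\<in>M. pos_op H A \<longrightarrow> \<phi> A \<in> \<real>\<^sub>\<ge>\<^sub>0)"

definition self_adjoint_part ::
  "'h::complex_hilbert set \<Rightarrow> ('h \<Rightarrow> 'h) set \<Rightarrow> ('h \<Rightarrow> 'h) set" where
  "self_adjoint_part H M = {A \<in> M. is_adjoint H A A}"

definition op_sup ::
  "'h::complex_hilbert set \<Rightarrow> ('h \<Rightarrow> 'h) set \<Rightarrow> ('h \<Rightarrow> 'h) set \<Rightarrow> ('h \<Rightarrow> 'h) \<Rightarrow> bool" where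
  "op_sup H M D S \<longleftrightarrow>
     S \<in> self_adjoint_part H M \<and> (\<forall>A\<in>D. op_le H A S) \<and>
     (\<forall>B\<in>self_adjoint_part H M. (\<forall>A\<in>D. op_le H A B) \<longrightarrow> op_le H S B)"

text \<open>
  Normality: preservation of suprema of increasing nets, expressed by upward directed sets.
\<close>

definition normal_functional ::
  "'h::complex_hilbert set \<Rightarrow> ('h \<Rightarrow> 'h) set \<Rightarrow> (('h \<Rightarrow> 'h) \<Rightarrow> complex) \<Rightarrow> bool" where
  "normal_functional H M \<phi> \<longleftrightarrow>
     (\<forall>D S. D \<subseteq> self_adjoint_part H M \<longrightarrow> D \<noteq> {} \<longrightarrow>
        (\<forall>A\<in>D. \<forall>B\<in>D. \<exists>C\<in>D. op_le H A C \<and> op_le H B C) \<longrightarrow>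
        op_sup H M D S \<longrightarrow> Re (\<phi> S) = (SUP A\<in>D. Re (\<phi> A)))"

definition states ::
  "'h::complex_hilbert set \<Rightarrow> ('h \<Rightarrow> 'h) set \<Rightarrow> (('h \<Rightarrow> 'h) \<Rightarrow> complex) set" where
  "states H M = {\<phi>. positive_functional H M \<phi> \<and> normal_functional H M \<phi> \<and> \<phi> (op_id H) = 1}"

definition tests :: "'h::complex_hilbert set \<Rightarrow> ('h \<Rightarrow> 'h) set \<Rightarrow> ('h \<Rightarrow> 'h) set" where
  "tests H M = {T \<in> M. op_le H (op_zero H) T \<and> op_le H T (op_id H)}"

definition state_alpha ::
  "'h::complex_hilbert set \<Rightarrow> (('h \<Rightarrow> 'h) \<Rightarrow> complex) \<Rightarrow> ('h \<Rightarrow> 'h) \<Rightarrow> real" where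
  "state_alpha H \<rho> T = Re (\<rho> (op_diff H (op_id H) T))"

definition state_beta :: "(('h \<Rightarrow> 'h) \<Rightarrow> complex) \<Rightarrow> ('h \<Rightarrow> 'h) \<Rightarrow> real" where
  "state_beta \<sigma> T = Re (\<sigma> T)"


section \<open>Hypotheses and error exponents\<close>

text \<open>
  The two ways in which a hypothesis enters an error exponent: \<open>Composite R\<close> is a sequence
  of sets of states whose worst-case error is considered, \<open>Indexed I \<rho>\<close> is a family with a
  fixed index set for which every index is considered separately.  The set \<open>t\<close> in the
  exponents \<open>e\<^sup>t\<close> consists of those \<open>k\<close> for which \<open>H\<^sub>k\<close> is \<open>Indexed\<close>.
\<close>

datatype ('i, 's) hypothesis =
    Composite "nat \<Rightarrow> 's set"
  | Indexed "'i set" "nat \<Rightarrow> 'i \<Rightarrow> 's"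

text \<open>
  The error sequences that are subject to an asymptotic condition, if the error
  in the \<open>n\<close>-th problem is \<open>f n s\<close> for the state \<open>s\<close>.
\<close>

fun error_seqs :: "('i, 's) hypothesis \<Rightarrow> (nat \<Rightarrow> 's \<Rightarrow> real) \<Rightarrow> (nat \<Rightarrow> real) set" where
  "error_seqs (Composite R) f = {\<lambda>n. SUP s\<in>R n. f n s}"
| "error_seqs (Indexed I \<rho>) f = (\<lambda>i n. f n (\<rho> n i)) ` I"

definition neg_log :: "real \<Rightarrow> ereal" where
  "neg_log p = (if p = 0 then \<infinity> else ereal (- ln p))"

definition decay_rate :: "(nat \<Rightarrow> real) \<Rightarrow> ereal" where
  "decay_rate p = liminf (\<lambda>n. ereal (1 / real n) * neg_log (p n))"

definition alpha_seqs ::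
  "(nat \<Rightarrow> 'h::complex_hilbert set) \<Rightarrow> ('i, ('h \<Rightarrow> 'h) \<Rightarrow> complex) hypothesis \<Rightarrow>
   (nat \<Rightarrow> 'h \<Rightarrow> 'h) \<Rightarrow> (nat \<Rightarrow> real) set" where
  "alpha_seqs H H0 T = error_seqs H0 (\<lambda>n \<rho>. state_alpha (H n) \<rho> (T n))"

definition beta_seqs ::
  "('j, ('h \<Rightarrow> 'h) \<Rightarrow> complex) hypothesis \<Rightarrow> (nat \<Rightarrow> 'h \<Rightarrow> 'h) \<Rightarrow> (nat \<Rightarrow> real) set" where
  "beta_seqs H1 T = error_seqs H1 (\<lambda>n \<sigma>. state_beta \<sigma> (T n))"

definition achievable ::
  "(nat \<Rightarrow> 'h::complex_hilbert set) \<Rightarrow> (nat \<Rightarrow> ('h \<Rightarrow> 'h) set) \<Rightarrow>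
   ('i, ('h \<Rightarrow> 'h) \<Rightarrow> complex) hypothesis \<Rightarrow> ('j, ('h \<Rightarrow> 'h) \<Rightarrow> complex) hypothesis \<Rightarrow>
   (ereal \<times> ereal) set" where
  "achievable H M H0 H1 = {(r, r'). 0 \<le> r \<and> 0 \<le> r' \<and>
     (\<exists>T. (\<forall>n. T n \<in> tests (H n) (M n)) \<and>
          (\<forall>b\<in>beta_seqs H1 T. r \<le> decay_rate b) \<and>
          (\<forall>a\<in>alpha_seqs H H0 T. r' \<le> decay_rate a))}"

definition direct_exponent ::
  "(nat \<Rightarrow> 'h::complex_hilbert set) \<Rightarrow> (nat \<Rightarrow> ('h \<Rightarrow> 'h) set) \<Rightarrow> ereal \<Rightarrow>
   ('i, ('h \<Rightarrow> 'h) \<Rightarrow> complex) hypothesis \<Rightarrow> ('j, ('h \<Rightarrow> 'h) \<Rightarrow> complex) hypothesis \<Rightarrow>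
   ereal" where
  "direct_exponent H M r H0 H1 = Sup {r'. (r, r') \<in> achievable H M H0 H1}"

definition chernoff_exponent ::
  "(nat \<Rightarrow> 'h::complex_hilbert set) \<Rightarrow> (nat \<Rightarrow> ('h \<Rightarrow> 'h) set) \<Rightarrow>
   ('i, ('h \<Rightarrow> 'h) \<Rightarrow> complex) hypothesis \<Rightarrow> ('j, ('h \<Rightarrow> 'h) \<Rightarrow> complex) hypothesis \<Rightarrow>
   ereal" where
  "chernoff_exponent H M H0 H1 = Sup {r. (r, r) \<in> achievable H M H0 H1}"

definition stein_exponent ::
  "(nat \<Rightarrow> 'h::complex_hilbert set) \<Rightarrow> (nat \<Rightarrow> ('h \<Rightarrow> 'h) set) \<Rightarrow>
   ('i, ('h \<Rightarrow> 'h) \<Rightarrow> complex) hypothesis \<Rightarrow> ('j, ('h \<Rightarrow> 'h) \<Rightarrow> complex) hypothesis \<Rightarrow>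
   ereal" where
  "stein_exponent H M H0 H1 = Sup {r. 0 \<le> r \<and>
     (\<exists>T. (\<forall>n. T n \<in> tests (H n) (M n)) \<and>
          (\<forall>b\<in>beta_seqs H1 T. r \<le> decay_rate b) \<and>
          (\<forall>a\<in>alpha_seqs H H0 T. a \<longlonglongrightarrow> 0))}"

end

theory Submission
  imports Defs
begin

text \<open>
  Let \<open>T\<^sub>i\<^sub>j\<close> be good tests for the pair \<open>\<rho>\<^sub>i\<close>, \<open>\<sigma>\<^sub>j\<close>.  In a commutative algebra the products
  \<open>B\<^sub>i = \<Prod>j<K. T\<^sub>i\<^sub>j\<close> and then \<open>T = 1 - (\<Prod>i<K. 1 - B\<^sub>i)\<close> are again tests, and for all \<open>i, j < K\<close>
  the error of \<open>T\<close> at \<open>\<rho>\<^sub>i\<close> is at most the sum over \<open>j < K\<close> of the errors of \<open>T\<^sub>i\<^sub>j\<close> at \<open>\<rho>\<^sub>i\<close>, and the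
  error of \<open>T\<close> at \<open>\<sigma>\<^sub>j\<close> is at most the sum over \<open>i < K\<close> of the errors of \<open>T\<^sub>i\<^sub>j\<close> at \<open>\<sigma>\<^sub>j\<close>.  If \<open>K = K n\<close>
  tends to infinity slowly enough, these sums decay at the same rate as their terms.
\<close>

section \<open>Products of commuting tests\<close>

text \<open>Commutativity enters to make products of tests positive; the rest of the algebra is a
  union bound. The other obstacle is uniformity. The tests for a pair satisfy their bounds only
  eventually, and infinitely many pairs need not have a common threshold. At stage n only finitely
  many indices take part, while every fixed index takes part from some stage on; this suffices
  because all conditions are asymptotic. One truncation has to serve the errors of both kinds. The
  exponents mix convergence to zero with decay at a prescribed rate. The argument sees only what
  these have in common: they pass to eventually smaller nonnegative sequences and to finite sums,
  and countably many eventual bounds decide them. This is why an abstract vanishing condition is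
  used. The suprema that define the exponents need not be attained, so the comparison is made level
  by level: a nonnegative level strictly below all the suprema is feasible for every pair, and the
  tests are combined at that level.\<close>

lemma cinner_add_left: "cinner (x + y) z = cinner x z + cinner y z"
  for x y z :: "'h::complex_hilbert"
  by (metis cinner_add_right cinner_commute complex_cnj_add)

lemma cinner_scaleC_left: "cinner (a *\<^sub>C x) y = cnj a * cinner x y"
  for x y :: "'h::complex_hilbert"
  by (metis cinner_commute cinner_scaleC_right complex_cnj_mult)

lemma scaleC_minus_one: "(-1) *\<^sub>C x = - x" for x :: "'h::complex_hilbert"
  using scaleR_scaleC[of "-1" x] by simp

lemma cinner_minus_right: "cinner x (- y) = - cinner x y" for x y :: "'h::complex_hilbert"
  by (metis cinner_scaleC_right mult_minus1 scaleC_minus_one)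

lemma cinner_minus_left: "cinner (- x) y = - cinner x y" for x y :: "'h::complex_hilbert"
  by (metis cinner_commute cinner_minus_right complex_cnj_minus)

lemma cinner_diff_right: "cinner x (y - z) = cinner x y - cinner x z"
  for x y z :: "'h::complex_hilbert"
  using cinner_add_right[of x y "- z"] by (simp add: cinner_minus_right)

lemma cinner_zero_right: "cinner x 0 = 0" for x :: "'h::complex_hilbert"
  using cinner_diff_right[of x 0 0] by simp

lemma cinner_diff_left: "cinner (x - y) z = cinner x z - cinner y z"
  for x y z :: "'h::complex_hilbert"
  using cinner_add_left[of x "- y" z] by (simp add: cinner_minus_left)

text \<open>Expressing the real part by norms reduces continuity of the inner product to continuity
  of the norm.\<close>

lemma Re_cinner_polarization: "Re (cinner x y) = ((norm (x + y))\<^sup>2 - (norm (x - y))\<^sup>2) / 4"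
  for x y :: "'h::complex_hilbert"
proof -
  have "Re (cinner y x) = Re (cinner x y)"
    by (subst cinner_commute) simp
  moreover have "(norm (x + y))\<^sup>2 = Re (cinner (x + y) (x + y))"
    "(norm (x - y))\<^sup>2 = Re (cinner (x - y) (x - y))"
    by (simp_all add: cinner_norm)
  ultimately show ?thesis
    by (simp add: cinner_add_left cinner_add_right cinner_diff_left cinner_diff_right)
qed

lemma tendsto_Re_cinner_zero:
  fixes y :: "nat \<Rightarrow> 'h::complex_hilbert"
  assumes "y \<longlonglongrightarrow> 0"
  shows "(\<lambda>n. Re (cinner (y n) z)) \<longlonglongrightarrow> 0"
proof -
  have "(\<lambda>n. ((norm (y n + z))\<^sup>2 - (norm (y n - z))\<^sup>2) / 4)
          \<longlonglongrightarrow> ((norm (0 + z))\<^sup>2 - (norm (0 - z))\<^sup>2) / 4"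
    by (intro tendsto_intros assms) auto
  then show ?thesis
    by (simp add: Re_cinner_polarization)
qed

lemma nonneg_Reals_iff: "z \<in> \<real>\<^sub>\<ge>\<^sub>0 \<longleftrightarrow> 0 \<le> Re z \<and> Im z = 0"
  by (simp add: complex_nonneg_Reals_iff)

section \<open>Effects and positivity of commuting products\<close>

text \<open>Operators such as \<open>\<lambda>x. A x - A (A x)\<close> need not be extensional and
  then lie outside \<open>bounded_ops H\<close>; linearity is therefore a property of the values on
  \<open>H\<close> alone.\<close>

definition linear_on :: "'h::complex_hilbert set \<Rightarrow> ('h \<Rightarrow> 'h) \<Rightarrow> bool" where
  "linear_on H A \<longleftrightarrow> (\<forall>x\<in>H. A x \<in> H) \<and> (\<forall>x\<in>H. \<forall>y\<in>H. A (x + y) = A x + A y) \<and>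
     (\<forall>c. \<forall>x\<in>H. A (c *\<^sub>C x) = c *\<^sub>C A x)"

definition is_effect :: "'h::complex_hilbert set \<Rightarrow> ('h \<Rightarrow> 'h) \<Rightarrow> bool" where
  "is_effect H A \<longleftrightarrow> linear_on H A \<and>
     (\<forall>x\<in>H. cinner x (A x) \<in> \<real>\<^sub>\<ge>\<^sub>0 \<and> Re (cinner x (A x)) \<le> (norm x)\<^sup>2)"

lemma csubspace_diff:
  assumes "closed_csubspace H" "x \<in> H" "y \<in> H"
  shows "x - y \<in> H"
proof -
  have "x + (-1) *\<^sub>C y \<in> H"
    using assms unfolding closed_csubspace_def by blast
  then show ?thesis
    by (simp add: scaleC_minus_one)
qed

lemma linear_on_diff:
  assumes "closed_csubspace H" "linear_on H A" "x \<in> H" "y \<in> H"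
  shows "A (x - y) = A x - A y"
proof -
  have "(-1) *\<^sub>C y \<in> H"
    using assms unfolding closed_csubspace_def by blast
  then have "A (x + (-1) *\<^sub>C y) = A x + (-1) *\<^sub>C A y"
    using assms unfolding linear_on_def by auto
  then show ?thesis
    by (simp add: scaleC_minus_one)
qed

text \<open>Positivity already forces self-adjointness, because the scalars are complex.\<close>

lemma positive_self_adjoint:
  assumes H: "closed_csubspace H" and A: "linear_on H A"
    and pos: "pos_op H A" and x: "x \<in> H" and y: "y \<in> H"
  shows "cinner (A x) y = cinner x (A y)"
proof -
  have real: "Im (cinner z (A z)) = 0" if "z \<in> H" for z
    using pos that by (simp add: pos_op_def nonneg_Reals_iff)
  have iy: "\<i> *\<^sub>C y \<in> H" and sums: "x + y \<in> H" "x + \<i> *\<^sub>C y \<in> H"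
    using H x y unfolding closed_csubspace_def by blast+
  have A1: "A (x + y) = A x + A y" and A2: "A (x + \<i> *\<^sub>C y) = A x + \<i> *\<^sub>C A y"
    using A x y iy unfolding linear_on_def by auto
  \<comment> \<open>Reality of the form at \<open>x + y\<close> relates the imaginary parts of the
    two cross terms, reality at \<open>x + \<i> *\<^sub>C y\<close> their real parts.\<close>
  have 1: "Im (cinner x (A y)) + Im (cinner y (A x)) = 0"
    using real[OF sums(1)] real[OF x] real[OF y]
    by (simp add: A1 cinner_add_left cinner_add_right)
  have 2: "Re (cinner x (A y)) - Re (cinner y (A x)) = 0"
    using real[OF sums(2)] real[OF x] real[OF y]
    by (simp add: A2 cinner_add_left cinner_add_right cinner_scaleC_left cinner_scaleC_right)
  have "cinner x (A y) = cnj (cinner y (A x))"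
    using 1 2 by (intro complex_eqI) auto
  then show ?thesis
    by (metis cinner_commute)
qed

text \<open>
  \<open>A - A\<^sup>2 = (1 - A) A (1 - A) + A (1 - A) A\<close> is positive for an effect \<open>A\<close>.
\<close>

lemma effect_diff_square:
  assumes H: "closed_csubspace H" and A: "is_effect H A"
  shows "is_effect H (\<lambda>x. A x - A (A x))"
proof -
  have lin: "linear_on H A" and pos: "\<And>x. x \<in> H \<Longrightarrow> cinner x (A x) \<in> \<real>\<^sub>\<ge>\<^sub>0"
    and le: "\<And>x. x \<in> H \<Longrightarrow> Re (cinner x (A x)) \<le> (norm x)\<^sup>2"
    using A by (auto simp: is_effect_def)
  have inH: "A x \<in> H" if "x \<in> H" for x
    using lin that by (auto simp: linear_on_def)
  have "pos_op H A"
    using pos by (simp add: pos_op_def)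
  note sa = positive_self_adjoint[OF H lin this]
  have linear: "linear_on H (\<lambda>x. A x - A (A x))"
  proof -
    have "c *\<^sub>C A x - c *\<^sub>C A (A x) = c *\<^sub>C (A x - A (A x))" for c x
      using scaleC_add_right[of c "A x - A (A x)" "A (A x)"] by simp
    then show ?thesis
      using lin inH csubspace_diff[OF H] by (auto simp: linear_on_def)
  qed
  have "cinner x (A x - A (A x)) \<in> \<real>\<^sub>\<ge>\<^sub>0 \<and> Re (cinner x (A x - A (A x))) \<le> (norm x)\<^sup>2"
    if x: "x \<in> H" for x
  proof -
    have sq: "cinner x (A (A x)) = of_real ((norm (A x))\<^sup>2)"
      using sa[OF x inH[OF x]] by (simp add: cinner_norm)
    let ?y = "x - A x"
    have y: "?y \<in> H"
      using csubspace_diff[OF H x inH[OF x]] .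
    have "cinner ?y (A ?y) = cinner x (A x) - 2 * cinner x (A (A x)) + cinner (A x) (A (A x))"
      using sa[OF x inH[OF x]] linear_on_diff[OF H lin x inH[OF x]]
      by (simp add: cinner_diff_left cinner_diff_right)
    then have "Re (cinner x (A x - A (A x))) =
        Re (cinner ?y (A ?y)) + ((norm (A x))\<^sup>2 - Re (cinner (A x) (A (A x))))"
      by (simp add: cinner_diff_right sq)
    moreover have "0 \<le> Re (cinner ?y (A ?y))"
      using pos[OF y] by (simp add: nonneg_Reals_iff)
    ultimately have "0 \<le> Re (cinner x (A x - A (A x)))"
      using le[OF inH[OF x]] by linarith
    moreover have "Im (cinner x (A x - A (A x))) = 0"
      using pos[OF x] sq by (simp add: cinner_diff_right nonneg_Reals_iff)
    moreover have "Re (cinner x (A x - A (A x))) \<le> (norm x)\<^sup>2"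
      using le[OF x] by (simp add: cinner_diff_right sq) (smt (verit) zero_le_power2)
    ultimately show ?thesis
      by (simp add: nonneg_Reals_iff)
  qed
  with linear show ?thesis
    by (simp add: is_effect_def)
qed

text \<open>
  Square roots are avoided: with \<open>A\<^sub>0 = A\<close> and \<open>A\<^sub>k\<^sub>+\<^sub>1 = A\<^sub>k - A\<^sub>k\<^sup>2\<close>, one has
  \<open>A = (\<Sum>k<n. A\<^sub>k\<^sup>2) + A\<^sub>n\<close>, every \<open>A\<^sub>k B A\<^sub>k\<close> is positive, and \<open>A\<^sub>n x\<close> tends to \<open>0\<close>.
\<close>

lemma positive_commuting_product:
  assumes H: "closed_csubspace H" and A: "is_effect H A"
    and B: "linear_on H B" and posB: "\<And>x. x \<in> H \<Longrightarrow> cinner x (B x) \<in> \<real>\<^sub>\<ge>\<^sub>0"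
    and comm: "\<And>x. x \<in> H \<Longrightarrow> A (B x) = B (A x)"
    and x: "x \<in> H"
  shows "cinner x (A (B x)) \<in> \<real>\<^sub>\<ge>\<^sub>0"
proof -
  define F where "F k = ((\<lambda>(C :: 'a \<Rightarrow> 'a) x. C x - C (C x)) ^^ k) A" for k
  have F_Suc: "F (Suc k) y = F k y - F k (F k y)" for k y
    by (simp add: F_def)
  have eff: "is_effect H (F k)" for k
  proof (induction k)
    case 0
    show ?case using A by (simp add: F_def)
  next
    case (Suc k)
    then show ?case
      using effect_diff_square[OF H Suc] by (simp add: F_def)
  qed
  have lin: "linear_on H (F k)" and pos: "\<And>z. z \<in> H \<Longrightarrow> cinner z (F k z) \<in> \<real>\<^sub>\<ge>\<^sub>0" for k
    using eff[of k] by (auto simp: is_effect_def)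
  have inH: "F k z \<in> H" if "z \<in> H" for k z
    using lin that by (auto simp: linear_on_def)
  have BinH: "B z \<in> H" if "z \<in> H" for z
    using B that by (auto simp: linear_on_def)
  have "pos_op H (F k)" for k
    using pos by (simp add: pos_op_def)
  note sa = positive_self_adjoint[OF H lin this]
  have "pos_op H B"
    using posB by (simp add: pos_op_def)
  note saB = positive_self_adjoint[OF H B this]
  have commF: "F k (B z) = B (F k z)" if "z \<in> H" for k z
    using that
  proof (induction k arbitrary: z)
    case 0
    then show ?case using comm by (simp add: F_def)
  next
    case (Suc k)
    then show ?case
      using linear_on_diff[OF H B inH[OF Suc.prems] inH[OF inH[OF Suc.prems]]]
      by (simp add: F_Suc inH)
  qed
  have step: "Re (cinner (F (Suc k) x) (B x)) \<le> Re (cinner (F k x) (B x))" for k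
  proof -
    have "cinner (F k (F k x)) (B x) = cinner (F k x) (B (F k x))"
      using sa[OF inH[OF x] BinH[OF x]] commF[OF x] by simp
    then show ?thesis
      using posB[OF inH[OF x, of k]] by (simp add: F_Suc cinner_diff_left nonneg_Reals_iff)
  qed
  have decr: "Re (cinner (F k x) (B x)) \<le> Re (cinner (A x) (B x))" for k
  proof (induction k)
    case 0
    show ?case by (simp add: F_def)
  next
    case (Suc k)
    then show ?case using step[of k] by linarith
  qed
  \<comment> \<open>The decomposition of \<open>A\<close> evaluated at \<open>x\<close>. Since the
    remainder is nonnegative, the sums of squares are bounded by the form of \<open>A\<close> at
    \<open>x\<close>; summability then forces \<open>F k x\<close> to tend to 0.\<close>
  have telescope: "(\<Sum>k<n. (norm (F k x))\<^sup>2) = Re (cinner x (A x)) - Re (cinner x (F n x))" for n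
  proof (induction n)
    case 0
    show ?case by (simp add: F_def)
  next
    case (Suc n)
    have "cinner x (F n (F n x)) = of_real ((norm (F n x))\<^sup>2)"
      using sa[OF x inH[OF x], of n n] by (simp add: cinner_norm)
    with Suc show ?case
      by (simp add: F_Suc cinner_diff_right)
  qed
  have "summable (\<lambda>k. (norm (F k x))\<^sup>2)"
  proof (rule summableI_nonneg_bounded)
    fix n
    show "(\<Sum>k<n. (norm (F k x))\<^sup>2) \<le> Re (cinner x (A x))"
      using pos[OF x, of n] by (simp add: telescope nonneg_Reals_iff)
  qed simp
  then have "(\<lambda>k. sqrt ((norm (F k x))\<^sup>2)) \<longlonglongrightarrow> sqrt 0"
    by (intro tendsto_real_sqrt summable_LIMSEQ_zero)
  then have "(\<lambda>k. F k x) \<longlonglongrightarrow> 0"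
    by (simp add: tendsto_norm_zero_iff)
  then have "(\<lambda>k. Re (cinner (F k x) (B x))) \<longlonglongrightarrow> 0"
    by (rule tendsto_Re_cinner_zero)
  then have "0 \<le> Re (cinner (A x) (B x))"
    by (rule LIMSEQ_le_const2) (use decr in auto)
  moreover have eq: "cinner (A x) (B x) = cinner x (A (B x))"
    using sa[OF x BinH[OF x], of 0] by (simp add: F_def)
  \<comment> \<open>The limit argument controls only the real part. The form is real because both
    factors are self-adjoint and commute.\<close>
  moreover have "cinner x (A (B x)) = cnj (cinner x (A (B x)))"
  proof -
    have "cinner x (A (B x)) = cinner x (B (A x))"
      using comm[OF x] by simp
    also have "\<dots> = cinner (B x) (A x)"
      using saB[OF x inH[OF x, of 0]] by (simp add: F_def)
    also have "\<dots> = cnj (cinner (A x) (B x))"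
      by (rule cinner_commute)
    finally show ?thesis
      by (simp add: eq)
  qed
  then have "Im (cinner x (A (B x))) = 0"
    by (metis Im_complex_of_real complex_cnj_cancel_iff Reals_cnj_iff complex_is_Real_iff)
  ultimately show ?thesis
    by (simp add: nonneg_Reals_iff)
qed

section \<open>Algebraic closure of commutants\<close>

lemma bounded_ops_linear: "A \<in> bounded_ops H \<Longrightarrow> linear_on H A"
  by (auto simp: bounded_ops_def linear_on_def PiE_def Pi_def)

lemma bounded_ops_bound:
  assumes "A \<in> bounded_ops H"
  obtains a where "\<And>x. x \<in> H \<Longrightarrow> norm (A x) \<le> a * norm x"
  using assms unfolding bounded_ops_def by blast

lemma commutant_subset: "commutant H X \<subseteq> bounded_ops H"
  by (auto simp: commutant_def)

lemma commutant_diff: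
  assumes H: "closed_csubspace H" and X: "X \<subseteq> bounded_ops H"
    and A: "A \<in> commutant H X" and B: "B \<in> commutant H X"
  shows "op_diff H A B \<in> commutant H X"
proof -
  have linA: "linear_on H A" and linB: "linear_on H B"
    and commA: "\<And>C. C \<in> X \<Longrightarrow> compose H A C = compose H C A"
    and commB: "\<And>C. C \<in> X \<Longrightarrow> compose H B C = compose H C B"
    using A B by (auto simp: commutant_def bounded_ops_linear)
  obtain a where a: "\<And>x. x \<in> H \<Longrightarrow> norm (A x) \<le> a * norm x"
    using A commutant_subset bounded_ops_bound by blast
  obtain b where b: "\<And>x. x \<in> H \<Longrightarrow> norm (B x) \<le> b * norm x"
    using B commutant_subset bounded_ops_bound by blast
  have "norm (A x - B x) \<le> (a + b) * norm x" if "x \<in> H" for x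
    using norm_triangle_ineq4[of "A x" "B x"] a[OF that] b[OF that]
    by (simp add: distrib_right)
  moreover have "c *\<^sub>C A x - c *\<^sub>C B x = c *\<^sub>C (A x - B x)" for c x
    using scaleC_add_right[of c "A x - B x" "B x"] by simp
  ultimately have "op_diff H A B \<in> bounded_ops H"
    using H linA linB csubspace_diff[OF H]
    unfolding bounded_ops_def op_diff_def linear_on_def closed_csubspace_def
    by (auto intro!: exI[of _ "a + b"])
  moreover have "compose H (op_diff H A B) C = compose H C (op_diff H A B)" if C: "C \<in> X" for C
  proof
    fix x
    have linC: "linear_on H C"
      using X C by (auto intro: bounded_ops_linear)
    show "compose H (op_diff H A B) C x = compose H C (op_diff H A B) x"
    proof (cases "x \<in> H")
      case True
      then have "A (C x) = C (A x)" "B (C x) = C (B x)" "C x \<in> H" "A x \<in> H" "B x \<in> H"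
        using fun_cong[OF commA[OF C], of x] fun_cong[OF commB[OF C], of x] linA linB linC
        by (auto simp: compose_def linear_on_def)
      with True show ?thesis
        by (simp add: compose_def op_diff_def linear_on_diff[OF H linC])
    qed (simp add: compose_def)
  qed
  ultimately show ?thesis
    by (simp add: commutant_def)
qed

lemma commutant_scale:
  assumes H: "closed_csubspace H" and X: "X \<subseteq> bounded_ops H" and A: "A \<in> commutant H X"
  shows "op_scale H c A \<in> commutant H X"
proof -
  have linA: "linear_on H A" and commA: "\<And>C. C \<in> X \<Longrightarrow> compose H A C = compose H C A"
    using A by (auto simp: commutant_def bounded_ops_linear)
  obtain a where a: "\<And>x. x \<in> H \<Longrightarrow> norm (A x) \<le> a * norm x"
    using A commutant_subset bounded_ops_bound by blast
  \<comment> \<open>The class axioms give homogeneity of the norm for real scalars; for complex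
    scalars it is derived from the inner product.\<close>
  have norm_scale: "norm (c *\<^sub>C z) = cmod c * norm z" for z :: 'a
  proof -
    have "complex_of_real ((norm (c *\<^sub>C z))\<^sup>2) = cnj c * (c * cinner z z)"
      by (simp only: cinner_norm[symmetric] cinner_scaleC_left cinner_scaleC_right mult.left_commute)
    also have "\<dots> = of_real ((cmod c * norm z)\<^sup>2)"
      using complex_norm_square[of c] by (simp add: cinner_norm power_mult_distrib mult_ac)
    finally have "(norm (c *\<^sub>C z))\<^sup>2 = (cmod c * norm z)\<^sup>2"
      using of_real_eq_iff by blast
    then show ?thesis
      by (simp add: power2_eq_iff_nonneg)
  qed
  have "norm (c *\<^sub>C A x) \<le> (cmod c * a) * norm x" if "x \<in> H" for x
    using mult_left_mono[OF a[OF that], of "cmod c"] by (simp add: norm_scale mult.assoc)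
  then have "op_scale H c A \<in> bounded_ops H"
    using H linA
    unfolding bounded_ops_def op_scale_def linear_on_def closed_csubspace_def
    by (auto intro!: exI[of _ "cmod c * a"] simp: scaleC_add_right scaleC_scaleC mult.commute)
  moreover have "compose H (op_scale H c A) C = compose H C (op_scale H c A)" if C: "C \<in> X" for C
  proof
    fix x
    have linC: "linear_on H C"
      using X C by (auto intro: bounded_ops_linear)
    show "compose H (op_scale H c A) C x = compose H C (op_scale H c A) x"
    proof (cases "x \<in> H")
      case True
      then have "A (C x) = C (A x)" "C x \<in> H" "A x \<in> H"
        using fun_cong[OF commA[OF C], of x] linA linC by (auto simp: compose_def linear_on_def)
      with True linC show ?thesis
        by (auto simp: compose_def op_scale_def linear_on_def)
    qed (simp add: compose_def)
  qed
  ultimately show ?thesis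
    by (simp add: commutant_def)
qed

lemma commutant_compose:
  assumes H: "closed_csubspace H" and X: "X \<subseteq> bounded_ops H"
    and A: "A \<in> commutant H X" and B: "B \<in> commutant H X"
  shows "compose H A B \<in> commutant H X"
proof -
  have linA: "linear_on H A" and linB: "linear_on H B"
    and commA: "\<And>C. C \<in> X \<Longrightarrow> compose H A C = compose H C A"
    and commB: "\<And>C. C \<in> X \<Longrightarrow> compose H B C = compose H C B"
    using A B by (auto simp: commutant_def bounded_ops_linear)
  obtain a where a: "\<And>x. x \<in> H \<Longrightarrow> norm (A x) \<le> a * norm x"
    using A commutant_subset bounded_ops_bound by blast
  obtain b where b: "\<And>x. x \<in> H \<Longrightarrow> norm (B x) \<le> b * norm x"
    using B commutant_subset bounded_ops_bound by blast
  have BinH: "B x \<in> H" if "x \<in> H" for x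
    using linB that by (auto simp: linear_on_def)
  \<comment> \<open>The bounding constant \<open>a\<close> has no sign condition, for instance on
    the zero space; its absolute value allows the bound for \<open>B x\<close> to be multiplied
    in.\<close>
  have "norm (A (B x)) \<le> (\<bar>a\<bar> * b) * norm x" if x: "x \<in> H" for x
  proof -
    have "norm (A (B x)) \<le> \<bar>a\<bar> * norm (B x)"
      using a[OF BinH[OF x]] by (meson abs_ge_self mult_right_mono norm_ge_zero order_trans)
    also have "\<dots> \<le> \<bar>a\<bar> * (b * norm x)"
      using b[OF x] by (intro mult_left_mono) auto
    finally show ?thesis
      by (simp add: mult.assoc)
  qed
  then have "compose H A B \<in> bounded_ops H"
    using H linA linB
    unfolding bounded_ops_def compose_def linear_on_def closed_csubspace_def
    by (auto intro!: exI[of _ "\<bar>a\<bar> * b"])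
  moreover have "compose H (compose H A B) C = compose H C (compose H A B)" if C: "C \<in> X" for C
  proof
    fix x
    have linC: "linear_on H C"
      using X C by (auto intro: bounded_ops_linear)
    show "compose H (compose H A B) C x = compose H C (compose H A B) x"
    proof (cases "x \<in> H")
      case True
      then have "B (C x) = C (B x)" "A (C (B x)) = C (A (B x))" "C x \<in> H"
        using fun_cong[OF commA[OF C], of "B x"] fun_cong[OF commB[OF C], of x] linC BinH
        by (auto simp: compose_def linear_on_def)
      with True show ?thesis
        by (simp add: compose_def)
    qed (simp add: compose_def)
  qed
  ultimately show ?thesis
    by (simp add: commutant_def)
qed

lemma commutant_id:
  assumes H: "closed_csubspace H" and X: "X \<subseteq> bounded_ops H"
  shows "op_id H \<in> commutant H X"
proof -
  have "op_id H \<in> bounded_ops H"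
    using H unfolding bounded_ops_def op_id_def closed_csubspace_def
    by (auto intro!: exI[of _ 1])
  moreover have "compose H (op_id H) C = compose H C (op_id H)" if C: "C \<in> X" for C
  proof -
    have "linear_on H C"
      using X C by (auto intro: bounded_ops_linear)
    then show ?thesis
      by (auto simp: compose_def op_id_def linear_on_def)
  qed
  ultimately show ?thesis
    by (simp add: commutant_def)
qed

text \<open>The definition of a von Neumann algebra lists no algebraic operations. They are
  inherited because \<open>M\<close> is itself a commutant, namely that of
  \<open>commutant H M\<close>.\<close>

lemma
  assumes "von_neumann_algebra H M"
  shows vna_id: "op_id H \<in> M"
    and vna_diff: "A \<in> M \<Longrightarrow> B \<in> M \<Longrightarrow> op_diff H A B \<in> M"
    and vna_scale: "A \<in> M \<Longrightarrow> op_scale H c A \<in> M"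
    and vna_compose: "A \<in> M \<Longrightarrow> B \<in> M \<Longrightarrow> compose H A B \<in> M"
proof -
  have H: "closed_csubspace H" and M: "commutant H (commutant H M) = M"
    and X: "commutant H M \<subseteq> bounded_ops H"
    using assms by (auto simp: von_neumann_algebra_def commutant_def)
  show "op_id H \<in> M"
    and "A \<in> M \<Longrightarrow> B \<in> M \<Longrightarrow> op_diff H A B \<in> M"
    and "A \<in> M \<Longrightarrow> op_scale H c A \<in> M"
    and "A \<in> M \<Longrightarrow> B \<in> M \<Longrightarrow> compose H A B \<in> M"
    using commutant_id[OF H X] commutant_diff[OF H X, of A B] commutant_scale[OF H X, of A c]
      commutant_compose[OF H X, of A B]
    by (simp_all add: M)
qed

section \<open>States and tests\<close>

lemma state_diff:
  assumes M: "von_neumann_algebra H M" and \<phi>: "\<phi> \<in> states H M" and "A \<in> M" "B \<in> M"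
  shows "\<phi> (op_diff H A B) = \<phi> A - \<phi> B"
proof -
  have "op_diff H A B = op_add H A (op_scale H (-1) B)"
    by (auto simp: op_diff_def op_add_def op_scale_def scaleC_minus_one restrict_def)
  then show ?thesis
    using assms vna_scale[OF M]
    by (simp add: states_def positive_functional_def linear_functional_def)
qed

lemma state_mono:
  assumes M: "von_neumann_algebra H M" and \<phi>: "\<phi> \<in> states H M" and "A \<in> M" "B \<in> M"
    and "op_le H A B"
  shows "Re (\<phi> A) \<le> Re (\<phi> B)"
proof -
  have "\<phi> (op_diff H B A) \<in> \<real>\<^sub>\<ge>\<^sub>0"
    using assms vna_diff[OF M] by (auto simp: states_def positive_functional_def op_le_def)
  then show ?thesis
    using state_diff[OF M \<phi> \<open>B \<in> M\<close> \<open>A \<in> M\<close>] by (simp add: nonneg_Reals_iff)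
qed

lemma tests_iff:
  assumes M: "von_neumann_algebra H M"
  shows "T \<in> tests H M \<longleftrightarrow> T \<in> M \<and> is_effect H T"
proof -
  have "linear_on H T" if "T \<in> M"
    using that M by (auto simp: von_neumann_algebra_def intro: bounded_ops_linear)
  then show ?thesis
    by (auto simp: tests_def is_effect_def op_le_def pos_op_def op_diff_def op_zero_def op_id_def
        cinner_diff_right cinner_norm nonneg_Reals_iff)
qed

lemma tests_subset: "T \<in> tests H M \<Longrightarrow> T \<in> M"
  by (simp add: tests_def)

text \<open>This form is symmetric in \<open>T\<close> and its complement, so complementing a test
  merely swaps the two conditions.\<close>

lemma tests_pointwise:
  "T \<in> tests H M \<longleftrightarrow>
     T \<in> M \<and> (\<forall>x\<in>H. cinner x (T x) \<in> \<real>\<^sub>\<ge>\<^sub>0 \<and> cinner x (x - T x) \<in> \<real>\<^sub>\<ge>\<^sub>0)"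
  by (auto simp: tests_def op_le_def pos_op_def op_diff_def op_zero_def op_id_def)

lemma test_complement:
  assumes M: "von_neumann_algebra H M" and T: "T \<in> tests H M"
  shows "op_diff H (op_id H) T \<in> tests H M"
proof -
  have "op_diff H (op_id H) T \<in> M"
    by (rule vna_diff[OF M vna_id[OF M] tests_subset[OF T]])
  moreover have "op_diff H (op_id H) T x = x - T x" if "x \<in> H" for x
    using that by (simp add: op_diff_def op_id_def)
  ultimately show ?thesis
    using T by (simp add: tests_pointwise)
qed

lemma test_id:
  assumes M: "von_neumann_algebra H M"
  shows "op_id H \<in> tests H M"
proof -
  have "op_id H x = x" if "x \<in> H" for x
    using that by (simp add: op_id_def)
  then show ?thesis
    using vna_id[OF M]
    by (simp add: tests_pointwise cinner_norm cinner_zero_right nonneg_Reals_iff)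
qed

lemma commuting_tests_product_positive:
  assumes M: "commutative_vna H M" and A: "A \<in> tests H M" and B: "B \<in> tests H M"
  shows "pos_op H (compose H A B)"
proof -
  have vna: "von_neumann_algebra H M" and H: "closed_csubspace H"
    using M by (auto simp: commutative_vna_def von_neumann_algebra_def)
  have eff: "is_effect H A" "is_effect H B"
    using A B tests_iff[OF vna] by auto
  have "compose H A B = compose H B A"
    using M tests_subset[OF A] tests_subset[OF B] by (auto simp: commutative_vna_def)
  then have "A (B x) = B (A x)" if "x \<in> H" for x
    using that by (metis compose_eq)
  then show ?thesis
    using positive_commuting_product[OF H eff(1)] eff(2)
    by (auto simp: pos_op_def compose_def is_effect_def)
qed

text \<open>\<open>A - A B = A (1 - B)\<close> is again a product of commuting tests, hence
  positive; then \<open>A B \<le> A \<le> 1\<close>.\<close>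

lemma
  assumes M: "commutative_vna H M" and A: "A \<in> tests H M" and B: "B \<in> tests H M"
  shows test_compose_le: "op_le H (compose H A B) A"
    and test_compose: "compose H A B \<in> tests H M"
proof -
  have vna: "von_neumann_algebra H M" and H: "closed_csubspace H"
    using M by (auto simp: commutative_vna_def von_neumann_algebra_def)
  have linA: "linear_on H A" and linB: "linear_on H B"
    using tests_iff[OF vna] A B by (auto simp: is_effect_def)
  have "op_diff H A (compose H A B) = compose H A (op_diff H (op_id H) B)"
    using linear_on_diff[OF H linA] linB
    by (auto simp: fun_eq_iff op_diff_def compose_def op_id_def linear_on_def)
  then show le: "op_le H (compose H A B) A"
    using commuting_tests_product_positive[OF M A test_complement[OF vna B]]
    by (simp add: op_le_def)
  have pos: "pos_op H (compose H A B)"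
    by (rule commuting_tests_product_positive[OF M A B])
  have "cinner x (x - A (B x)) \<in> \<real>\<^sub>\<ge>\<^sub>0" if x: "x \<in> H" for x
  proof -
    have "cinner x (x - A x) \<in> \<real>\<^sub>\<ge>\<^sub>0" "cinner x (A x - A (B x)) \<in> \<real>\<^sub>\<ge>\<^sub>0"
      using A le x
      by (auto simp: tests_def op_le_def pos_op_def op_diff_def op_id_def compose_def)
    then show ?thesis
      by (simp add: cinner_diff_right nonneg_Reals_iff)
  qed
  then show "compose H A B \<in> tests H M"
    using pos vna_compose[OF vna tests_subset[OF A] tests_subset[OF B]]
    by (auto simp: tests_def op_le_def pos_op_def op_diff_def op_zero_def op_id_def compose_def)
qed

lemma
  assumes M: "von_neumann_algebra H M" and s: "s \<in> states H M" and T: "T \<in> tests H M"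
  shows state_alpha_eq: "state_alpha H s T = 1 - state_beta s T"
    and state_beta_nonneg: "0 \<le> state_beta s T"
    and state_beta_le_one: "state_beta s T \<le> 1"
proof -
  have one: "s (op_id H) = 1"
    using s by (simp add: states_def)
  show eq: "state_alpha H s T = 1 - state_beta s T"
    using state_diff[OF M s vna_id[OF M] tests_subset[OF T]] one
    by (simp add: state_alpha_def state_beta_def)
  have "pos_op H T"
    using T by (auto simp: tests_def op_le_def pos_op_def op_diff_def op_zero_def)
  then show "0 \<le> state_beta s T"
    using s tests_subset[OF T]
    by (auto simp: states_def positive_functional_def state_beta_def nonneg_Reals_iff)
  show "state_beta s T \<le> 1"
    using state_mono[OF M s tests_subset[OF T] vna_id[OF M]] T one
    by (auto simp: tests_def state_beta_def)
qed

lemma state_alpha_nonneg: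
  assumes "von_neumann_algebra H M" "s \<in> states H M" "T \<in> tests H M"
  shows "0 \<le> state_alpha H s T"
  using state_alpha_eq[OF assms] state_beta_le_one[OF assms] by simp

lemma state_alpha_le_one:
  assumes "von_neumann_algebra H M" "s \<in> states H M" "T \<in> tests H M"
  shows "state_alpha H s T \<le> 1"
  using state_alpha_eq[OF assms] state_beta_nonneg[OF assms] by simp

section \<open>Meets and joins of finitely many tests\<close>

text \<open>A product of commuting tests behaves like an intersection of events:
  \<open>1 - T A = (1 - A) + (1 - T) A\<close> with \<open>(1 - T) A \<le> 1 - T\<close> is the
  union bound, and the product lies below each factor. The test is chosen before the state, which
  later permits suprema over sets of states.\<close>

lemma test_meet:
  assumes M: "commutative_vna H M" and A: "\<And>j::nat. A j \<in> tests H M"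
  shows "\<exists>T\<in>tests H M. \<forall>s\<in>states H M.
     state_alpha H s T \<le> (\<Sum>j<K. state_alpha H s (A j)) \<and>
     (\<forall>j<K. state_beta s T \<le> state_beta s (A j))"
proof (induction K)
  case 0
  have vna: "von_neumann_algebra H M"
    using M by (simp add: commutative_vna_def)
  have "state_alpha H s (op_id H) = 0" if "s \<in> states H M" for s
    using state_alpha_eq[OF vna that test_id[OF vna]] that
    by (simp add: state_beta_def states_def)
  then show ?case
    by (intro bexI[OF _ test_id[OF vna]]) auto
next
  case (Suc K)
  have vna: "von_neumann_algebra H M" and H: "closed_csubspace H"
    using M by (auto simp: commutative_vna_def von_neumann_algebra_def)
  obtain T where T: "T \<in> tests H M"
    and le: "\<And>s. s \<in> states H M \<Longrightarrow> state_alpha H s T \<le> (\<Sum>j<K. state_alpha H s (A j))"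
      "\<And>s j. s \<in> states H M \<Longrightarrow> j < K \<Longrightarrow> state_beta s T \<le> state_beta s (A j)"
    using Suc by blast
  let ?U = "compose H T (A K)"
  let ?T' = "op_diff H (op_id H) T"
  have U: "?U \<in> tests H M"
    by (rule test_compose[OF M T A])
  have UT: "state_beta s ?U \<le> state_beta s T" if "s \<in> states H M" for s
    using state_mono[OF vna that tests_subset[OF U] tests_subset[OF T] test_compose_le[OF M T A]]
    by (simp add: state_beta_def)
  have comm: "?U = compose H (A K) T"
    using M tests_subset[OF T] tests_subset[OF A] by (auto simp: commutative_vna_def)
  have UA: "state_beta s ?U \<le> state_beta s (A K)" if "s \<in> states H M" for s
    using state_mono[OF vna that tests_subset[OF U] tests_subset[OF A]] test_compose_le[OF M A T]
    by (simp add: state_beta_def comm)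
  have alpha: "state_alpha H s ?U \<le> state_alpha H s T + state_alpha H s (A K)"
    if s: "s \<in> states H M" for s
  proof -
    have T': "?T' \<in> tests H M"
      by (rule test_complement[OF vna T])
    have linA: "linear_on H (A K)" and linT: "linear_on H T"
      using tests_iff[OF vna] A T by (auto simp: is_effect_def)
    have "compose H (A K) ?T' = op_diff H (A K) ?U"
      unfolding comm
      using linear_on_diff[OF H linA] linT
      by (auto simp: fun_eq_iff op_diff_def compose_def op_id_def linear_on_def)
    then have "state_beta s (A K) - state_beta s ?U = state_beta s (compose H (A K) ?T')"
      using state_diff[OF vna s tests_subset[OF A] tests_subset[OF U]]
      by (simp add: state_beta_def)
    also have "\<dots> = state_beta s (compose H ?T' (A K))"
      using M tests_subset[OF T'] tests_subset[OF A] by (auto simp: commutative_vna_def)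
    also have "\<dots> \<le> state_beta s ?T'"
      using state_mono[OF vna s tests_subset[OF test_compose[OF M T' A]] tests_subset[OF T']
          test_compose_le[OF M T' A]]
      by (simp add: state_beta_def)
    also have "\<dots> = state_alpha H s T"
      by (simp add: state_beta_def state_alpha_def)
    finally show ?thesis
      using state_alpha_eq[OF vna s U] state_alpha_eq[OF vna s A, of K] by linarith
  qed
  have "\<forall>s\<in>states H M. state_alpha H s ?U \<le> (\<Sum>j<Suc K. state_alpha H s (A j)) \<and>
     (\<forall>j<Suc K. state_beta s ?U \<le> state_beta s (A j))"
    using alpha UT UA le by (fastforce simp: less_Suc_eq)
  then show ?case
    using U by blast
qed

text \<open>Complementation exchanges the two errors, so this is \<open>test_meet\<close> for the
  complements of the \<open>A i\<close>, complemented once more.\<close>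

lemma test_join:
  assumes M: "commutative_vna H M" and A: "\<And>i::nat. A i \<in> tests H M"
  shows "\<exists>T\<in>tests H M. \<forall>s\<in>states H M.
     state_beta s T \<le> (\<Sum>i<K. state_beta s (A i)) \<and>
     (\<forall>i<K. state_alpha H s T \<le> state_alpha H s (A i))"
proof -
  have vna: "von_neumann_algebra H M"
    using M by (simp add: commutative_vna_def)
  let ?c = "op_diff H (op_id H)"
  have swap: "state_beta s (?c T) = state_alpha H s T" "state_alpha H s (?c T) = state_beta s T"
    if "s \<in> states H M" "T \<in> tests H M" for s T
    using that state_alpha_eq[OF vna that(1) test_complement[OF vna that(2)]]
      state_alpha_eq[OF vna that]
    by (simp_all add: state_beta_def state_alpha_def)
  obtain T where T: "T \<in> tests H M"
    and le: "\<And>s. s \<in> states H M \<Longrightarrow> state_alpha H s T \<le> (\<Sum>i<K. state_alpha H s (?c (A i)))"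
      "\<And>s i. s \<in> states H M \<Longrightarrow> i < K \<Longrightarrow> state_beta s T \<le> state_beta s (?c (A i))"
    using test_meet[OF M, where A = "\<lambda>i. ?c (A i)" and K = K] test_complement[OF vna A] by blast
  show ?thesis
    using le by (intro bexI[OF _ test_complement[OF vna T]]) (simp add: swap T A)
qed

lemma test_combine:
  assumes M: "commutative_vna H M" and A: "\<And>(i::nat) (j::nat). A i j \<in> tests H M"
  shows "\<exists>T\<in>tests H M. \<forall>s\<in>states H M.
     (\<forall>i<K. state_alpha H s T \<le> (\<Sum>j<K. state_alpha H s (A i j))) \<and>
     (\<forall>j<K. state_beta s T \<le> (\<Sum>i<K. state_beta s (A i j)))"
proof -
  have "\<forall>i. \<exists>T\<in>tests H M. \<forall>s\<in>states H M.
     state_alpha H s T \<le> (\<Sum>j<K. state_alpha H s (A i j)) \<and>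
     (\<forall>j<K. state_beta s T \<le> state_beta s (A i j))"
  proof
    fix i
    show "\<exists>T\<in>tests H M. \<forall>s\<in>states H M.
       state_alpha H s T \<le> (\<Sum>j<K. state_alpha H s (A i j)) \<and>
       (\<forall>j<K. state_beta s T \<le> state_beta s (A i j))"
      by (rule test_meet[OF M A])
  qed
  then obtain B where B: "\<And>i. B i \<in> tests H M"
    and leB: "\<And>i s. s \<in> states H M \<Longrightarrow> state_alpha H s (B i) \<le> (\<Sum>j<K. state_alpha H s (A i j))"
      "\<And>i j s. s \<in> states H M \<Longrightarrow> j < K \<Longrightarrow> state_beta s (B i) \<le> state_beta s (A i j)"
    by metis
  obtain T where T: "T \<in> tests H M"
    and le: "\<And>s. s \<in> states H M \<Longrightarrow> state_beta s T \<le> (\<Sum>i<K. state_beta s (B i))"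
      "\<And>s i. s \<in> states H M \<Longrightarrow> i < K \<Longrightarrow> state_alpha H s T \<le> state_alpha H s (B i)"
    using test_join[OF M, where A = B and K = K] B by blast
  have "state_beta s T \<le> (\<Sum>i<K. state_beta s (A i j))" if "s \<in> states H M" "j < K" for s j
    using le(1)[OF that(1)] sum_mono[of "{..<K}", OF leB(2)[OF that]] by (meson order_trans)
  moreover have "state_alpha H s T \<le> (\<Sum>j<K. state_alpha H s (A i j))"
    if "s \<in> states H M" "i < K" for s i
    using le(2)[OF that] leB(1)[OF that(1), of i] by linarith
  ultimately show ?thesis
    using T by blast
qed


section \<open>Vanishing conditions on error sequences\<close>

text \<open>
  A common form of \<open>p \<longlonglongrightarrow> 0\<close> and \<open>x \<le> decay_rate p\<close>: countably many eventual bounds, such that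
  half of every bound is eventually implied by another one.  The former gives diagonal sequences,
  the latter sums.
\<close>

definition bounds_characterize :: "(nat \<Rightarrow> nat \<Rightarrow> real) \<Rightarrow> ((nat \<Rightarrow> real) \<Rightarrow> bool) \<Rightarrow> bool" where
  "bounds_characterize c P \<longleftrightarrow>
     (\<forall>l n. 0 \<le> c l n) \<and>
     (\<forall>l. \<exists>l'. \<forall>\<^sub>F n in sequentially. 2 * c l' n \<le> c l n) \<and>
     (\<forall>p. (\<forall>n. 0 \<le> p n) \<longrightarrow> P p \<longleftrightarrow> (\<forall>l. \<forall>\<^sub>F n in sequentially. p n \<le> c l n))"

definition vanishing_condition :: "((nat \<Rightarrow> real) \<Rightarrow> bool) \<Rightarrow> bool" where
  "vanishing_condition P \<longleftrightarrow> (\<exists>c. bounds_characterize c P)"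

lemma bounds_characterizeD:
  assumes "bounds_characterize c P" and "\<And>n. 0 \<le> p n"
  shows "P p \<longleftrightarrow> (\<forall>l. \<forall>\<^sub>F n in sequentially. p n \<le> c l n)"
  using assms unfolding bounds_characterize_def by simp

text \<open>Domination is only eventual because a test truncated at \<open>K n\<close> obeys the
  bound for index \<open>i\<close> only once \<open>i < K n\<close>.\<close>

lemma vanishing_condition_mono:
  assumes P: "vanishing_condition P" and q: "P q"
    and nonneg: "\<And>n. 0 \<le> p n" "\<And>n. 0 \<le> q n"
    and le: "\<forall>\<^sub>F n in sequentially. p n \<le> q n"
  shows "P p"
proof -
  obtain c where base: "bounds_characterize c P"
    using P unfolding vanishing_condition_def by blast
  note c = bounds_characterizeD[OF base]
  have "\<forall>\<^sub>F n in sequentially. p n \<le> c l n" for l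
  proof -
    have "\<forall>\<^sub>F n in sequentially. q n \<le> c l n"
      using q c[OF nonneg(2)] by simp
    with le show ?thesis
      by eventually_elim linarith
  qed
  then show ?thesis
    using c[OF nonneg(1)] by simp
qed

lemma vanishing_condition_zero:
  assumes "vanishing_condition P"
  shows "P (\<lambda>n. 0)"
proof -
  obtain c where base: "bounds_characterize c P"
    using assms unfolding vanishing_condition_def by blast
  note c = bounds_characterizeD[OF base]
  then show ?thesis
    using c[of "\<lambda>n. 0"] base by (simp add: bounds_characterize_def)
qed

lemma vanishing_condition_add:
  assumes P: "vanishing_condition P" and pq: "P p" "P q"
    and nonneg: "\<And>n. 0 \<le> p n" "\<And>n. 0 \<le> q n"
  shows "P (\<lambda>n. p n + q n)"
proof -
  obtain c where base: "bounds_characterize c P"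
    using P unfolding vanishing_condition_def by blast
  note c = bounds_characterizeD[OF base]
  have "\<forall>\<^sub>F n in sequentially. p n + q n \<le> c l n" for l
  proof -
    obtain l' where "\<forall>\<^sub>F n in sequentially. 2 * c l' n \<le> c l n"
      using base unfolding bounds_characterize_def by blast
    moreover have "\<forall>\<^sub>F n in sequentially. p n \<le> c l' n" "\<forall>\<^sub>F n in sequentially. q n \<le> c l' n"
      using pq c[OF nonneg(1)] c[OF nonneg(2)] by simp_all
    ultimately show ?thesis
      by eventually_elim linarith
  qed
  then show ?thesis
    using c nonneg by (simp add: add_nonneg_nonneg)
qed

lemma vanishing_condition_sum:
  assumes P: "vanishing_condition P" and "finite F"
    and "\<And>k. k \<in> F \<Longrightarrow> P (p k)" and nonneg: "\<And>k n. k \<in> F \<Longrightarrow> 0 \<le> p k n"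
  shows "P (\<lambda>n. \<Sum>k\<in>F. p k n)"
  using assms(2-)
proof (induction F)
  case empty
  show ?case
    using vanishing_condition_zero[OF P] by simp
next
  case (insert x F)
  then have "P (\<lambda>n. p x n + (\<Sum>k\<in>F. p k n))"
    by (intro vanishing_condition_add[OF P]) (auto intro: sum_nonneg)
  then show ?case
    using insert.hyps by simp
qed

text \<open>
  \<open>K n\<close> is the largest \<open>k \<le> n\<close> for which the first \<open>k\<close> bounds hold for the sums of length \<open>k\<close>
  in the first \<open>k\<close> rows.
\<close>

lemma vanishing_condition_diagonal:
  fixes p :: "nat \<Rightarrow> nat \<Rightarrow> nat \<Rightarrow> real"
  assumes P: "vanishing_condition P" and p: "\<And>i j. P (p i j)"
    and nonneg: "\<And>i j n. 0 \<le> p i j n"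
  shows "\<exists>K. filterlim K at_top sequentially \<and>
    (\<forall>K' i. (\<forall>n. K' n \<le> K n) \<longrightarrow> P (\<lambda>n. \<Sum>j<K' n. p i j n))"
proof -
  obtain c where base: "bounds_characterize c P"
    using P unfolding vanishing_condition_def by blast
  note c = bounds_characterizeD[OF base]
  define good where "good n k \<longleftrightarrow> (\<forall>i<k. \<forall>l<k. (\<Sum>j<k. p i j n) \<le> c l n)" for n k
  define K where "K n = (GREATEST k. k \<le> n \<and> good n k)" for n
  \<comment> \<open>The greatest element exists: \<open>good n 0\<close> holds vacuously, and
    \<open>k \<le> n\<close> caps the candidates.\<close>
  have K_good: "K n \<le> n \<and> good n (K n)" for n
    unfolding K_def by (rule GreatestI_nat[of _ 0 n]) (auto simp: good_def)
  have K_ge: "k \<le> K n" if "k \<le> n" "good n k" for k n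
    unfolding K_def using that by (intro Greatest_le_nat[of _ k n]) auto
  have "\<forall>\<^sub>F n in sequentially. k \<le> K n" for k
  proof -
    have "\<forall>\<^sub>F n in sequentially. (\<Sum>j<k. p i j n) \<le> c l n" for i l
    proof -
      have "P (\<lambda>n. \<Sum>j<k. p i j n)"
        using p nonneg by (intro vanishing_condition_sum[OF P]) auto
      then show ?thesis
        using c nonneg by (simp add: sum_nonneg)
    qed
    then have "\<forall>\<^sub>F n in sequentially. \<forall>i\<in>{..<k}. \<forall>l\<in>{..<k}. (\<Sum>j<k. p i j n) \<le> c l n"
      by (intro eventually_ball_finite ballI) auto
    with eventually_ge_at_top[of k] show ?thesis
      by eventually_elim (auto intro: K_ge simp: good_def)
  qed
  then have "filterlim K at_top sequentially"
    by (simp add: filterlim_at_top)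
  moreover have "P (\<lambda>n. \<Sum>j<K' n. p i j n)" if K': "\<forall>n. K' n \<le> K n" for K' i
  proof -
    have "\<forall>\<^sub>F n in sequentially. (\<Sum>j<K' n. p i j n) \<le> c l n" for l
      using \<open>\<forall>\<^sub>F n in sequentially. Suc (max i l) \<le> K n\<close>
    proof eventually_elim
      case (elim n)
      have "(\<Sum>j<K' n. p i j n) \<le> (\<Sum>j<K n. p i j n)"
        using K' nonneg by (intro sum_mono2) auto
      also have "\<dots> \<le> c l n"
        using K_good[of n] elim by (auto simp: good_def)
      finally show ?case .
    qed
    then show ?thesis
      using c nonneg by (simp add: sum_nonneg)
  qed
  ultimately show ?thesis
    by (intro exI[of _ K]) simp
qed

section \<open>Convergence to zero and decay rates as vanishing conditions\<close>

lemma vanishing_condition_tendsto: "vanishing_condition (\<lambda>p. p \<longlonglongrightarrow> 0)"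
proof -
  have "p \<longlonglongrightarrow> 0 \<longleftrightarrow> (\<forall>l. \<forall>\<^sub>F n in sequentially. p n \<le> inverse (real (Suc l)))"
    if p: "\<forall>n. 0 \<le> p n" for p :: "nat \<Rightarrow> real"
  proof
    assume "p \<longlonglongrightarrow> 0"
    then have "\<forall>\<^sub>F n in sequentially. p n < inverse (real (Suc l))" for l
      by (rule order_tendstoD(2)) simp
    then show "\<forall>l. \<forall>\<^sub>F n in sequentially. p n \<le> inverse (real (Suc l))"
      using eventually_mono less_imp_le by meson
  next
    assume *: "\<forall>l. \<forall>\<^sub>F n in sequentially. p n \<le> inverse (real (Suc l))"
    show "p \<longlonglongrightarrow> 0"
    proof (rule tendstoI)
      fix e :: real
      assume "0 < e"
      then obtain l where l: "inverse (real (Suc l)) < e"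
        using reals_Archimedean by blast
      from *[rule_format, of l] show "\<forall>\<^sub>F n in sequentially. dist (p n) 0 < e"
        by eventually_elim (use p l in \<open>auto simp: dist_real_def intro: le_less_trans\<close>)
    qed
  qed
  \<comment> \<open>The index \<open>2 * l + 1\<close> halves the bound exactly: 2 / (2 l + 2) = 1 /
    (l + 1).\<close>
  moreover have "2 * inverse (real (Suc (Suc (2 * l)))) \<le> inverse (real (Suc l))" for l
    by (simp add: field_simps)
  then have "\<exists>l'. \<forall>\<^sub>F n in sequentially. 2 * inverse (real (Suc l')) \<le> inverse (real (Suc l))" for l
    by (intro exI[of _ "Suc (2 * l)"]) simp
  ultimately show ?thesis
    unfolding vanishing_condition_def bounds_characterize_def
    by (intro exI[of _ "\<lambda>l n. inverse (real (Suc l))"]) auto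
qed

text \<open>Turns a rate into an exponential bound on the error itself; \<open>p = 0\<close> is
  covered by the value \<infinity> of \<open>neg_log\<close>. Positivity of \<open>n\<close>
  matters, since \<open>1 / real 0 = 0\<close>.\<close>

lemma le_neg_log_iff:
  assumes "0 \<le> p" and n: "0 < n"
  shows "ereal u \<le> ereal (1 / real n) * neg_log p \<longleftrightarrow> p \<le> exp (- (real n * u))"
proof (cases "p = 0")
  case True
  then show ?thesis
    using n by (simp add: neg_log_def)
next
  case False
  with assms have "0 < p"
    by simp
  then have "ereal u \<le> ereal (1 / real n) * neg_log p \<longleftrightarrow> ln p \<le> - (real n * u)"
    using n by (auto simp add: neg_log_def field_simps)
  also have "\<dots> \<longleftrightarrow> p \<le> exp (- (real n * u))"
    using \<open>0 < p\<close> by (metis exp_le_cancel_iff exp_ln)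
  finally show ?thesis .
qed

text \<open>The bounds are \<open>exp (- (real n * u l))\<close> with real \<open>u l\<close>
  strictly below \<open>x\<close> and tending to \<open>x\<close>, which treats finite and infinite
  \<open>x\<close> alike. Strictness leaves room: if \<open>u l < u l'\<close>, the ratio of the
  later bound to the earlier one tends to 0, so a factor 2 costs no rate.\<close>

lemma vanishing_condition_decay_rate:
  assumes x: "0 \<le> x"
  shows "vanishing_condition (\<lambda>p. x \<le> decay_rate p)"
proof -
  obtain u :: "nat \<Rightarrow> real" where u: "\<And>l. ereal (u l) < x" "(\<lambda>l. ereal (u l)) \<longlonglongrightarrow> x"
  proof (cases x)
    case (real r)
    then show ?thesis
      using that[of "\<lambda>l. r - inverse (real (Suc l))"]
      by (simp add: LIMSEQ_inverse_real_of_nat_add_minus[of r, simplified])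
  next
    case PInf
    then show ?thesis
      using that[of real] by (simp add: tendsto_PInfty_eq_at_top filterlim_real_sequentially)
  qed (use x in auto)
  have later: "\<exists>l'. y < ereal (u l')" if "y < x" for y
    using order_tendstoD(1)[OF u(2) that] by (auto simp: eventually_sequentially)
  have "\<exists>l'. \<forall>\<^sub>F n in sequentially. 2 * exp (- (real n * u l')) \<le> exp (- (real n * u l))" for l
  proof -
    obtain l' where "u l < u l'"
      using later[OF u(1)[of l]] by auto
    then have "filterlim (\<lambda>n. real n * (u l' - u l)) at_top sequentially"
      by (intro filterlim_at_top_mult_tendsto_pos[where c = "u l' - u l"] filterlim_real_sequentially)
        (auto simp: mult.commute)
    then have "\<forall>\<^sub>F n in sequentially. ln 2 \<le> real n * (u l' - u l)"
      by (simp add: filterlim_at_top)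
    then have "\<forall>\<^sub>F n in sequentially. 2 * exp (- (real n * u l')) \<le> exp (- (real n * u l))"
    proof eventually_elim
      case (elim n)
      have "2 * exp (- (real n * u l')) = exp (ln 2 - real n * u l')"
        by (simp add: exp_diff exp_minus field_simps)
      also have "\<dots> \<le> exp (- (real n * u l))"
        using elim by (simp add: algebra_simps)
      finally show ?case .
    qed
    then show ?thesis ..
  qed
  moreover have "x \<le> decay_rate p \<longleftrightarrow>
      (\<forall>l. \<forall>\<^sub>F n in sequentially. p n \<le> exp (- (real n * u l)))" if p: "\<forall>n. 0 \<le> p n" for p
  proof -
    let ?q = "\<lambda>n. ereal (1 / real n) * neg_log (p n)"
    have iff: "(\<forall>\<^sub>F n in sequentially. ereal (u l) \<le> ?q n) \<longleftrightarrow>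
        (\<forall>\<^sub>F n in sequentially. p n \<le> exp (- (real n * u l)))" for l
      by (rule eventually_cong[OF eventually_gt_at_top[of 0]]) (simp add: le_neg_log_iff p)
    have "x \<le> decay_rate p \<longleftrightarrow> (\<forall>l. \<forall>\<^sub>F n in sequentially. ereal (u l) \<le> ?q n)"
      unfolding decay_rate_def le_Liminf_iff
    proof (intro iffI allI impI)
      fix l
      assume "\<forall>y<x. \<forall>\<^sub>F n in sequentially. y < ?q n"
      with u(1)[of l] show "\<forall>\<^sub>F n in sequentially. ereal (u l) \<le> ?q n"
        by (auto elim!: eventually_mono)
    next
      fix y
      assume *: "\<forall>l. \<forall>\<^sub>F n in sequentially. ereal (u l) \<le> ?q n" and "y < x"
      then obtain l where l: "y < ereal (u l)"
        using later by blast
      from * have "\<forall>\<^sub>F n in sequentially. ereal (u l) \<le> ?q n" ..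
      then show "\<forall>\<^sub>F n in sequentially. y < ?q n"
        by eventually_elim (use l in \<open>auto intro: less_le_trans\<close>)
    qed
    then show ?thesis
      by (simp add: iff)
  qed
  ultimately show ?thesis
    unfolding vanishing_condition_def bounds_characterize_def
    by (intro exI[of _ "\<lambda>l n. exp (- (real n * u l))"]) auto
qed

text \<open>A finite supremum of nonnegative terms lies between each term and their sum, and
  vanishing conditions survive both domination and finite sums.\<close>

lemma vanishing_condition_SUP_finite:
  assumes P: "vanishing_condition P" and F: "finite F" "F \<noteq> {}"
    and nonneg: "\<And>n i. i \<in> F \<Longrightarrow> 0 \<le> f n (g n i)"
  shows "P (\<lambda>n. SUP s\<in>g n ` F. f n s) \<longleftrightarrow> (\<forall>i\<in>F. P (\<lambda>n. f n (g n i)))"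
proof
  have bdd: "bdd_above ((\<lambda>s. f n s) ` g n ` F)" for n
    using F by simp
  have upper: "f n (g n i) \<le> (SUP s\<in>g n ` F. f n s)" if "i \<in> F" for n i
    using that by (intro cSUP_upper bdd) auto
  have sup_nonneg: "0 \<le> (SUP s\<in>g n ` F. f n s)" for n
    using F(2) upper nonneg by (meson all_not_in_conv order_trans)
  show "\<forall>i\<in>F. P (\<lambda>n. f n (g n i))" if *: "P (\<lambda>n. SUP s\<in>g n ` F. f n s)"
  proof
    fix i
    assume "i \<in> F"
    then show "P (\<lambda>n. f n (g n i))"
      using vanishing_condition_mono[OF P *, of "\<lambda>n. f n (g n i)"] nonneg upper sup_nonneg by simp
  qed
  show "P (\<lambda>n. SUP s\<in>g n ` F. f n s)" if *: "\<forall>i\<in>F. P (\<lambda>n. f n (g n i))"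
  proof (rule vanishing_condition_mono[OF P])
    show "P (\<lambda>n. \<Sum>i\<in>F. f n (g n i))"
      using * nonneg F by (intro vanishing_condition_sum[OF P]) auto
    show "\<forall>\<^sub>F n in sequentially. (SUP s\<in>g n ` F. f n s) \<le> (\<Sum>i\<in>F. f n (g n i))"
    proof (intro always_eventually allI cSUP_least)
      show "g n ` F \<noteq> {}" for n
        using F by simp
      show "f n s \<le> (\<Sum>i\<in>F. f n (g n i))" if "s \<in> g n ` F" for n s
        using that nonneg F by (auto intro: member_le_sum)
    qed
  qed (use nonneg sup_nonneg in \<open>auto intro: sum_nonneg\<close>)
qed

section \<open>Combining countably many sequences of tests\<close>

text \<open>Errors are at most 1, so the real suprema over \<open>R\<close> are taken over bounded
  sets and are true upper bounds.\<close>

lemma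
  assumes "von_neumann_algebra H M" "T \<in> tests H M" "R \<subseteq> states H M" "s \<in> R"
  shows state_alpha_le_SUP: "state_alpha H s T \<le> (SUP s\<in>R. state_alpha H s T)"
    and state_beta_le_SUP: "state_beta s T \<le> (SUP s\<in>R. state_beta s T)"
proof -
  have "state_alpha H s T \<le> 1 \<and> state_beta s T \<le> 1" if "s \<in> R" for s
    using state_alpha_le_one state_beta_le_one assms that by blast
  then have "bdd_above ((\<lambda>s. state_alpha H s T) ` R)" "bdd_above ((\<lambda>s. state_beta s T) ` R)"
    by (auto intro!: bdd_aboveI[of _ 1])
  then show "state_alpha H s T \<le> (SUP s\<in>R. state_alpha H s T)"
    "state_beta s T \<le> (SUP s\<in>R. state_beta s T)"
    using assms(4) by (auto intro: cSUP_upper)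
qed

lemma
  assumes "von_neumann_algebra H M" "T \<in> tests H M" "R \<subseteq> states H M" "R \<noteq> {}"
  shows SUP_state_alpha_nonneg: "0 \<le> (SUP s\<in>R. state_alpha H s T)"
    and SUP_state_beta_nonneg: "0 \<le> (SUP s\<in>R. state_beta s T)"
proof -
  obtain s where s: "s \<in> R"
    using assms by blast
  show "0 \<le> (SUP s\<in>R. state_alpha H s T)"
    using state_alpha_le_SUP[OF assms(1-3) s] state_alpha_nonneg[of H M s T] assms s
    by (meson order_trans subsetD)
  show "0 \<le> (SUP s\<in>R. state_beta s T)"
    using state_beta_le_SUP[OF assms(1-3) s] state_beta_nonneg[of H M s T] assms s
    by (meson order_trans subsetD)
qed

lemma simultaneous_tests_nat:
  fixes R S :: "nat \<Rightarrow> nat \<Rightarrow> (('h::complex_hilbert \<Rightarrow> 'h) \<Rightarrow> complex) set"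
  assumes M: "\<And>n. commutative_vna (H n) (M n)"
    and P: "vanishing_condition P" and Q: "vanishing_condition Q"
    and R: "\<And>i n. R i n \<subseteq> states (H n) (M n)" "\<And>i n. R i n \<noteq> {}"
    and S: "\<And>j n. S j n \<subseteq> states (H n) (M n)" "\<And>j n. S j n \<noteq> {}"
    and A: "\<And>i j n. A i j n \<in> tests (H n) (M n)"
    and AP: "\<And>i j. P (\<lambda>n. SUP s\<in>R i n. state_alpha (H n) s (A i j n))"
    and AQ: "\<And>i j. Q (\<lambda>n. SUP s\<in>S j n. state_beta s (A i j n))"
  shows "\<exists>T. (\<forall>n. T n \<in> tests (H n) (M n)) \<and>
    (\<forall>i. P (\<lambda>n. SUP s\<in>R i n. state_alpha (H n) s (T n))) \<and>
    (\<forall>j. Q (\<lambda>n. SUP s\<in>S j n. state_beta s (T n)))"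
proof -
  define a where "a i T n = (SUP s\<in>R i n. state_alpha (H n) s (T n))" for i T n
  define b where "b j T n = (SUP s\<in>S j n. state_beta s (T n))" for j T n
  have vna: "von_neumann_algebra (H n) (M n)" for n
    using M[of n] by (simp add: commutative_vna_def)
  have AP': "P (a i (A i j))" and AQ': "Q (b j (A i j))" for i j
    using AP AQ by (simp_all add: a_def[abs_def] b_def[abs_def])
  have nonneg: "0 \<le> a i T n" "0 \<le> b j T n" if "\<And>n. T n \<in> tests (H n) (M n)" for i j T n
    unfolding a_def b_def
    using SUP_state_alpha_nonneg[OF vna that R] SUP_state_beta_nonneg[OF vna that S] by auto
  obtain K1 where K1: "filterlim K1 at_top sequentially"
    "\<forall>K' i. (\<forall>n. K' n \<le> K1 n) \<longrightarrow> P (\<lambda>n. \<Sum>j<K' n. a i (A i j) n)"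
    using vanishing_condition_diagonal[OF P, of "\<lambda>i j. a i (A i j)", OF AP' nonneg(1)[OF A]]
    by blast
  obtain K2 where K2: "filterlim K2 at_top sequentially"
    "\<forall>K' j. (\<forall>n. K' n \<le> K2 n) \<longrightarrow> Q (\<lambda>n. \<Sum>i<K' n. b j (A i j) n)"
    using vanishing_condition_diagonal[OF Q, of "\<lambda>j i. b j (A i j)", OF AQ' nonneg(2)[OF A]]
    by blast
  \<comment> \<open>\<open>K1\<close> controls the sums over \<open>j\<close> for \<open>P\<close>,
    \<open>K2\<close> the sums over \<open>i\<close> for \<open>Q\<close>, with rows and columns
    exchanged. The minimum serves both because each diagonal statement also allows shorter
    sums.\<close>
  define K where "K n = min (K1 n) (K2 n)" for n
  have K: "\<forall>\<^sub>F n in sequentially. i < K n" for i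
    using filterlim_at_top[THEN iffD1, OF K1(1), rule_format, of "Suc i"]
      filterlim_at_top[THEN iffD1, OF K2(1), rule_format, of "Suc i"]
    by eventually_elim (simp add: K_def)
  have "\<exists>T. T \<in> tests (H n) (M n) \<and> (\<forall>s\<in>states (H n) (M n).
     (\<forall>i<K n. state_alpha (H n) s T \<le> (\<Sum>j<K n. state_alpha (H n) s (A i j n))) \<and>
     (\<forall>j<K n. state_beta s T \<le> (\<Sum>i<K n. state_beta s (A i j n))))" for n
    using test_combine[OF M A] unfolding Bex_def .
  then have "\<forall>n. \<exists>T. T \<in> tests (H n) (M n) \<and> (\<forall>s\<in>states (H n) (M n).
     (\<forall>i<K n. state_alpha (H n) s T \<le> (\<Sum>j<K n. state_alpha (H n) s (A i j n))) \<and>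
     (\<forall>j<K n. state_beta s T \<le> (\<Sum>i<K n. state_beta s (A i j n))))"
    by (rule allI)
  from choice[OF this] obtain T where
    "\<forall>n. T n \<in> tests (H n) (M n) \<and> (\<forall>s\<in>states (H n) (M n).
     (\<forall>i<K n. state_alpha (H n) s (T n) \<le> (\<Sum>j<K n. state_alpha (H n) s (A i j n))) \<and>
     (\<forall>j<K n. state_beta s (T n) \<le> (\<Sum>i<K n. state_beta s (A i j n))))" ..
  then have T: "\<And>n. T n \<in> tests (H n) (M n)"
    and le: "\<And>n s i. s \<in> states (H n) (M n) \<Longrightarrow> i < K n \<Longrightarrow>
        state_alpha (H n) s (T n) \<le> (\<Sum>j<K n. state_alpha (H n) s (A i j n))"
      "\<And>n s j. s \<in> states (H n) (M n) \<Longrightarrow> j < K n \<Longrightarrow>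
        state_beta s (T n) \<le> (\<Sum>i<K n. state_beta s (A i j n))"
    by blast+
  \<comment> \<open>One test obeys the union bound at every state, so the supremum over
    \<open>R i n\<close> can be taken afterwards; the supremum of a sum is at most the sum of the
    suprema.\<close>
  have a_le: "a i T n \<le> (\<Sum>j<K n. a i (A i j) n)" if "i < K n" for i n
    unfolding a_def
  proof (rule cSUP_least[OF R(2)])
    fix s
    assume s: "s \<in> R i n"
    have "state_alpha (H n) s (T n) \<le> (\<Sum>j<K n. state_alpha (H n) s (A i j n))"
      using le(1) R(1) s that by blast
    also have "\<dots> \<le> (\<Sum>j<K n. SUP s\<in>R i n. state_alpha (H n) s (A i j n))"
      by (intro sum_mono state_alpha_le_SUP[OF vna A R(1) s])
    finally show "state_alpha (H n) s (T n) \<le> \<dots>" .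
  qed
  have b_le: "b j T n \<le> (\<Sum>i<K n. b j (A i j) n)" if "j < K n" for j n
    unfolding b_def
  proof (rule cSUP_least[OF S(2)])
    fix s
    assume s: "s \<in> S j n"
    have "state_beta s (T n) \<le> (\<Sum>i<K n. state_beta s (A i j n))"
      using le(2) S(1) s that by blast
    also have "\<dots> \<le> (\<Sum>i<K n. SUP s\<in>S j n. state_beta s (A i j n))"
      by (intro sum_mono state_beta_le_SUP[OF vna A S(1) s])
    finally show "state_beta s (T n) \<le> \<dots>" .
  qed
  have "P (a i T)" for i
  proof (rule vanishing_condition_mono[OF P])
    show "P (\<lambda>n. \<Sum>j<K n. a i (A i j) n)"
      by (rule K1(2)[rule_format]) (simp add: K_def)
    show "\<forall>\<^sub>F n in sequentially. a i T n \<le> (\<Sum>j<K n. a i (A i j) n)"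
      using K[of i] by eventually_elim (rule a_le)
  qed (use nonneg T A in \<open>auto intro: sum_nonneg\<close>)
  moreover have "Q (b j T)" for j
  proof (rule vanishing_condition_mono[OF Q])
    show "Q (\<lambda>n. \<Sum>i<K n. b j (A i j) n)"
      by (rule K2(2)[rule_format]) (simp add: K_def)
    show "\<forall>\<^sub>F n in sequentially. b j T n \<le> (\<Sum>i<K n. b j (A i j) n)"
      using K[of j] by eventually_elim (rule b_le)
  qed (use nonneg T A in \<open>auto intro: sum_nonneg\<close>)
  ultimately show ?thesis
    using T by (intro exI[of _ T]) (simp add: a_def[abs_def] b_def[abs_def])
qed

section \<open>Feasibility for families of hypotheses\<close>

text \<open>The shape shared by the constraints of all three exponents at a fixed level, with
  \<open>P\<close> imposed on the first error and \<open>Q\<close> on the second.\<close>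

definition feasible ::
  "(nat \<Rightarrow> 'h::complex_hilbert set) \<Rightarrow> (nat \<Rightarrow> ('h \<Rightarrow> 'h) set) \<Rightarrow>
   ((nat \<Rightarrow> real) \<Rightarrow> bool) \<Rightarrow> ((nat \<Rightarrow> real) \<Rightarrow> bool) \<Rightarrow>
   ('i, ('h \<Rightarrow> 'h) \<Rightarrow> complex) hypothesis \<Rightarrow> ('j, ('h \<Rightarrow> 'h) \<Rightarrow> complex) hypothesis \<Rightarrow> bool" where
  "feasible H M P Q H0 H1 \<longleftrightarrow> (\<exists>T. (\<forall>n. T n \<in> tests (H n) (M n)) \<and>
     (\<forall>b\<in>beta_seqs H1 T. Q b) \<and> (\<forall>a\<in>alpha_seqs H H0 T. P a))"

text \<open>
  Both kinds of hypotheses are families of sequences of sets: \<open>Composite R\<close> has one member \<open>R\<close>, and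
  the members of \<open>Indexed I \<rho>\<close> are singletons.
\<close>

definition has_members :: "('i, 's) hypothesis \<Rightarrow> 'i set \<Rightarrow> ('i \<Rightarrow> nat \<Rightarrow> 's set) \<Rightarrow> bool" where
  "has_members h I R \<longleftrightarrow> (\<forall>f. error_seqs h f = (\<lambda>i n. SUP s\<in>R i n. f n s) ` I)"

lemma has_members_Composite: "has_members (Composite R) {i} (\<lambda>_. R)"
  by (simp add: has_members_def)

lemma has_members_Indexed: "has_members (Indexed I \<rho>) I (\<lambda>i n. {\<rho> n i})"
  by (simp add: has_members_def)

text \<open>Tests that work for the families work for each pair. Conversely, tests are chosen for
  every pair and the index sets are enumerated by the naturals, where the diagonal construction
  applies.\<close>

lemma feasible_iff_members:
  assumes M: "\<And>n. commutative_vna (H n) (M n)"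
    and P: "vanishing_condition P" and Q: "vanishing_condition Q"
    and I: "countable I" "I \<noteq> {}" and J: "countable J" "J \<noteq> {}"
    and R: "\<And>i n. i \<in> I \<Longrightarrow> R i n \<subseteq> states (H n) (M n)" "\<And>i n. i \<in> I \<Longrightarrow> R i n \<noteq> {}"
    and S: "\<And>j n. j \<in> J \<Longrightarrow> S j n \<subseteq> states (H n) (M n)" "\<And>j n. j \<in> J \<Longrightarrow> S j n \<noteq> {}"
    and H0: "has_members H0 I R" and H1: "has_members H1 J S"
  shows "feasible H M P Q H0 H1 \<longleftrightarrow>
     (\<forall>i\<in>I. \<forall>j\<in>J. feasible H M P Q (Composite (R i)) (Composite (S j)))"
proof
  show "\<forall>i\<in>I. \<forall>j\<in>J. feasible H M P Q (Composite (R i)) (Composite (S j))"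
    if "feasible H M P Q H0 H1"
    using that H0 H1
    by (auto simp: feasible_def alpha_seqs_def beta_seqs_def has_members_def)
next
  assume "\<forall>i\<in>I. \<forall>j\<in>J. feasible H M P Q (Composite (R i)) (Composite (S j))"
  then have "\<forall>i\<in>I. \<forall>j\<in>J. \<exists>T. (\<forall>n. T n \<in> tests (H n) (M n)) \<and>
      Q (\<lambda>n. SUP s\<in>S j n. state_beta s (T n)) \<and>
      P (\<lambda>n. SUP s\<in>R i n. state_alpha (H n) s (T n))"
    by (simp add: feasible_def alpha_seqs_def beta_seqs_def)
  then obtain A where A: "\<forall>i\<in>I. \<forall>j\<in>J. (\<forall>n. A i j n \<in> tests (H n) (M n)) \<and>
      Q (\<lambda>n. SUP s\<in>S j n. state_beta s (A i j n)) \<and>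
      P (\<lambda>n. SUP s\<in>R i n. state_alpha (H n) s (A i j n))"
    unfolding bchoice_iff by blast
  \<comment> \<open>These enumerations run over all naturals and may repeat members. A repetition
    only repeats a condition, so finite and infinite index sets are treated alike.\<close>
  let ?i = "from_nat_into I" and ?j = "from_nat_into J"
  have in_sets: "?i m \<in> I" "?j m \<in> J" for m
    using I J by (simp_all add: from_nat_into)
  have "\<exists>T. (\<forall>n. T n \<in> tests (H n) (M n)) \<and>
      (\<forall>m. P (\<lambda>n. SUP s\<in>R (?i m) n. state_alpha (H n) s (T n))) \<and>
      (\<forall>m. Q (\<lambda>n. SUP s\<in>S (?j m) n. state_beta s (T n)))"
    by (rule simultaneous_tests_nat[OF M P Q, where A = "\<lambda>k l. A (?i k) (?j l)"])
      (use A R S in_sets in simp_all)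
  then obtain T where T: "\<And>n. T n \<in> tests (H n) (M n)"
    "\<And>m. P (\<lambda>n. SUP s\<in>R (?i m) n. state_alpha (H n) s (T n))"
    "\<And>m. Q (\<lambda>n. SUP s\<in>S (?j m) n. state_beta s (T n))"
    by blast
  have "P (\<lambda>n. SUP s\<in>R i n. state_alpha (H n) s (T n))" if i: "i \<in> I" for i
  proof -
    obtain m where "?i m = i"
      using from_nat_into_surj[OF I(1) i] by blast
    then show ?thesis
      using T(2)[of m] by simp
  qed
  moreover have "Q (\<lambda>n. SUP s\<in>S j n. state_beta s (T n))" if j: "j \<in> J" for j
  proof -
    obtain m where "?j m = j"
      using from_nat_into_surj[OF J(1) j] by blast
    then show ?thesis
      using T(3)[of m] by simp
  qed
  ultimately show "feasible H M P Q H0 H1"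
    unfolding feasible_def using T(1) H0 H1
    by (intro exI[of _ T]) (simp add: alpha_seqs_def beta_seqs_def has_members_def)
qed

section \<open>Error exponents\<close>

text \<open>The exponents differ only in which condition carries the level \<open>x\<close>: the one
  on the second error for Stein, both for Chernoff, the one on the first error for the direct
  exponent, whose other condition stays at \<open>r\<close>. Monotonicity in \<open>x\<close> makes
  the feasible levels downward closed.\<close>

lemma exponent_as_Sup_feasible:
  assumes e: "e = stein_exponent H M \<or> e = chernoff_exponent H M \<or>
    (\<exists>r>0. e = direct_exponent H M r)"
  obtains P Q where "\<And>x. 0 \<le> x \<Longrightarrow> vanishing_condition (P x)"
    and "\<And>x. 0 \<le> x \<Longrightarrow> vanishing_condition (Q x)"
    and "\<And>x y p. x \<le> y \<Longrightarrow> P y p \<Longrightarrow> P x p" and "\<And>x y p. x \<le> y \<Longrightarrow> Q y p \<Longrightarrow> Q x p"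
    and "\<And>H0 H1. e H0 H1 = Sup {x::ereal. 0 \<le> x \<and> feasible H M (P x) (Q x) H0 H1}"
proof -
  let ?D = "\<lambda>(x::ereal) p. x \<le> decay_rate p"
  consider "e = stein_exponent H M" | "e = chernoff_exponent H M"
    | r where "r > 0" "e = direct_exponent H M r"
    using e by blast
  then show ?thesis
  proof cases
    case 1
    show ?thesis
    proof (rule that[of "\<lambda>_ p. p \<longlonglongrightarrow> 0" ?D])
      show "e H0 H1 = Sup {x. 0 \<le> x \<and> feasible H M (\<lambda>p. p \<longlonglongrightarrow> 0) (?D x) H0 H1}" for H0 H1
        by (simp add: 1 stein_exponent_def feasible_def)
    qed (auto intro: vanishing_condition_tendsto vanishing_condition_decay_rate)
  next
    case 2
    show ?thesis
    proof (rule that[of ?D ?D])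
      show "e H0 H1 = Sup {x. 0 \<le> x \<and> feasible H M (?D x) (?D x) H0 H1}" for H0 H1
        by (simp add: 2 chernoff_exponent_def achievable_def feasible_def)
    qed (auto intro: vanishing_condition_decay_rate)
  next
    case 3
    show ?thesis
    proof (rule that[of ?D "\<lambda>_. ?D r"])
      show "e H0 H1 = Sup {x. 0 \<le> x \<and> feasible H M (?D x) (?D r) H0 H1}" for H0 H1
        using 3 by (simp add: less_imp_le direct_exponent_def achievable_def feasible_def)
    qed (use 3 in \<open>auto intro: vanishing_condition_decay_rate\<close>)
  qed
qed

text \<open>A nonnegative level strictly below every \<open>Sup (X k)\<close> lies in every
  \<open>X k\<close> by downward closure. Working strictly below, and using density of the order,
  avoids asking whether the suprema are attained.\<close>

lemma Sup_feasible_eq_INF: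
  fixes X :: "'a \<Rightarrow> ereal set"
  assumes down: "\<And>k x y. k \<in> K \<Longrightarrow> 0 \<le> x \<Longrightarrow> x \<le> y \<Longrightarrow> y \<in> X k \<Longrightarrow> x \<in> X k"
    and nonneg: "\<And>k x. k \<in> K \<Longrightarrow> x \<in> X k \<Longrightarrow> 0 \<le> x"
  shows "Sup {x. 0 \<le> x \<and> (\<forall>k\<in>K. x \<in> X k)} = (INF k\<in>K. Sup (X k))"
proof (rule antisym)
  show "Sup {x. 0 \<le> x \<and> (\<forall>k\<in>K. x \<in> X k)} \<le> (INF k\<in>K. Sup (X k))"
    by (auto intro!: INF_greatest Sup_least Sup_upper)
  show "(INF k\<in>K. Sup (X k)) \<le> Sup {x. 0 \<le> x \<and> (\<forall>k\<in>K. x \<in> X k)}"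
  proof (rule dense_le)
    fix x
    assume x: "x < (INF k\<in>K. Sup (X k))"
    \<comment> \<open>Levels are nonnegative, but \<open>x\<close> may be negative. Any
      \<open>y\<close> in \<open>X k\<close> above \<open>x\<close> is also at least 0, so it
      dominates \<open>max x 0\<close>.\<close>
    have "max x 0 \<in> X k" if k: "k \<in> K" for k
    proof -
      obtain y where "y \<in> X k" "x < y"
        using less_INF_D[OF x k] by (auto simp: less_Sup_iff)
      then show ?thesis
        using down[OF k, of "max x 0" y] nonneg[OF k] by auto
    qed
    then have "max x 0 \<le> Sup {x. 0 \<le> x \<and> (\<forall>k\<in>K. x \<in> X k)}"
      by (intro Sup_upper) auto
    then show "x \<le> Sup {x. 0 \<le> x \<and> (\<forall>k\<in>K. x \<in> X k)}"
      by (meson max.cobounded1 order_trans)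
  qed
qed

text \<open>All three infimum formulas are instances of this one, a composite side being a family
  with a single member.\<close>

lemma exponent_eq_INF_members:
  fixes H :: "nat \<Rightarrow> 'h::complex_hilbert set"
    and R :: "'i \<Rightarrow> nat \<Rightarrow> (('h \<Rightarrow> 'h) \<Rightarrow> complex) set"
    and S :: "'j \<Rightarrow> nat \<Rightarrow> (('h \<Rightarrow> 'h) \<Rightarrow> complex) set"
  assumes M: "\<And>n. commutative_vna (H n) (M n)"
    and e: "e = stein_exponent H M \<or> e = chernoff_exponent H M \<or>
      (\<exists>r>0. e = direct_exponent H M r)"
    and I: "countable I" "I \<noteq> {}" and J: "countable J" "J \<noteq> {}"
    and R: "\<And>i n. i \<in> I \<Longrightarrow> R i n \<subseteq> states (H n) (M n)" "\<And>i n. i \<in> I \<Longrightarrow> R i n \<noteq> {}"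
    and S: "\<And>j n. j \<in> J \<Longrightarrow> S j n \<subseteq> states (H n) (M n)" "\<And>j n. j \<in> J \<Longrightarrow> S j n \<noteq> {}"
    and H0: "has_members H0 I R" and H1: "has_members H1 J S"
  shows "e H0 H1 = (INF (i, j)\<in>I \<times> J. e (Composite (R i)) (Composite (S j)))"
proof -
  obtain P Q where vanishing: "\<And>x. 0 \<le> x \<Longrightarrow> vanishing_condition (P x)"
      "\<And>x. 0 \<le> x \<Longrightarrow> vanishing_condition (Q x)"
    and antimono: "\<And>x y p. x \<le> y \<Longrightarrow> P y p \<Longrightarrow> P x p" "\<And>x y p. x \<le> y \<Longrightarrow> Q y p \<Longrightarrow> Q x p"
    and e_eq: "\<And>H0 H1. e H0 H1 = Sup {x::ereal. 0 \<le> x \<and> feasible H M (P x) (Q x) H0 H1}"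
    using exponent_as_Sup_feasible[OF e] by blast
  define X where "X = (\<lambda>(i, j). {x. 0 \<le> x \<and>
    feasible H M (P x) (Q x) (Composite (R i) :: ('i, _) hypothesis)
      (Composite (S j) :: ('j, _) hypothesis)})"
  have "{x. 0 \<le> x \<and> feasible H M (P x) (Q x) H0 H1} = {x. 0 \<le> x \<and> (\<forall>k\<in>I \<times> J. x \<in> X k)}"
    using feasible_iff_members[OF M vanishing I J R S H0 H1] by (auto simp: X_def)
  then have "e H0 H1 = Sup {x. 0 \<le> x \<and> (\<forall>k\<in>I \<times> J. x \<in> X k)}"
    by (simp add: e_eq)
  also have "\<dots> = (INF k\<in>I \<times> J. Sup (X k))"
  proof (rule Sup_feasible_eq_INF)
    show "x \<in> X k" if "0 \<le> x" "x \<le> y" "y \<in> X k" for k x y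
      using that antimono[OF that(2)] unfolding X_def feasible_def
      by (auto split: prod.splits)
    show "0 \<le> x" if "x \<in> X k" for k x
      using that by (auto simp: X_def split: prod.splits)
  qed
  also have "\<dots> = (INF (i, j)\<in>I \<times> J. e (Composite (R i)) (Composite (S j)))"
    by (intro INF_cong) (auto simp: X_def e_eq)
  finally show ?thesis .
qed


text \<open>Asking for agreement under every vanishing condition covers all exponents at all levels
  at once, so the finite case is checked just once for each hypothesis.\<close>

lemma exponent_cong:
  assumes e: "e = stein_exponent H M \<or> e = chernoff_exponent H M \<or>
      (\<exists>r>0. e = direct_exponent H M r)"
    and alpha: "\<And>P T. vanishing_condition P \<Longrightarrow> (\<And>n. T n \<in> tests (H n) (M n)) \<Longrightarrow>
      (\<forall>a\<in>alpha_seqs H H0 T. P a) \<longleftrightarrow> (\<forall>a\<in>alpha_seqs H H0' T. P a)"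
    and beta: "\<And>P T. vanishing_condition P \<Longrightarrow> (\<And>n. T n \<in> tests (H n) (M n)) \<Longrightarrow>
      (\<forall>b\<in>beta_seqs H1 T. P b) \<longleftrightarrow> (\<forall>b\<in>beta_seqs H1' T. P b)"
  shows "e H0 H1 = e H0' H1'"
proof -
  obtain P Q where vanishing: "\<And>x. 0 \<le> x \<Longrightarrow> vanishing_condition (P x)"
      "\<And>x. 0 \<le> x \<Longrightarrow> vanishing_condition (Q x)"
    and "\<And>x y p. x \<le> y \<Longrightarrow> P y p \<Longrightarrow> P x p" "\<And>x y p. x \<le> y \<Longrightarrow> Q y p \<Longrightarrow> Q x p"
    and e_eq: "\<And>H0 H1. e H0 H1 = Sup {x::ereal. 0 \<le> x \<and> feasible H M (P x) (Q x) H0 H1}"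
    using exponent_as_Sup_feasible[OF e] by blast
  have "feasible H M (P x) (Q x) H0 H1 \<longleftrightarrow> feasible H M (P x) (Q x) H0' H1'" if "0 \<le> x" for x
    unfolding feasible_def
    using alpha[OF vanishing(1)[OF that]] beta[OF vanishing(2)[OF that]]
    by (intro iff_exI conj_cong refl) simp_all
  then show ?thesis
    unfolding e_eq by (metis (no_types, lifting))
qed

lemma alpha_seqs_finite:
  assumes P: "vanishing_condition P" and T: "\<And>n. T n \<in> tests (H n) (M n)"
    and M: "\<And>n. von_neumann_algebra (H n) (M n)" and I: "finite I" "I \<noteq> {}"
    and states: "\<And>n i. i \<in> I \<Longrightarrow> \<rho> n i \<in> states (H n) (M n)"
  shows "(\<forall>a\<in>alpha_seqs H (Indexed I \<rho>) T. P a) \<longleftrightarrow>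
    (\<forall>a\<in>alpha_seqs H (Composite (\<lambda>n. \<rho> n ` I)) T. P a)"
  using vanishing_condition_SUP_finite[OF P I, of "\<lambda>n s. state_alpha (H n) s (T n)" \<rho>]
    state_alpha_nonneg[OF M states T]
  by (simp add: alpha_seqs_def)

lemma beta_seqs_finite:
  assumes P: "vanishing_condition P" and T: "\<And>n. T n \<in> tests (H n) (M n)"
    and M: "\<And>n. von_neumann_algebra (H n) (M n)" and J: "finite J" "J \<noteq> {}"
    and states: "\<And>n j. j \<in> J \<Longrightarrow> \<sigma> n j \<in> states (H n) (M n)"
  shows "(\<forall>b\<in>beta_seqs (Indexed J \<sigma>) T. P b) \<longleftrightarrow>
    (\<forall>b\<in>beta_seqs (Composite (\<lambda>n. \<sigma> n ` J)) T. P b)"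
  using vanishing_condition_SUP_finite[OF P J, of "\<lambda>n s. state_beta s (T n)" \<sigma>]
    state_beta_nonneg[OF M states T]
  by (simp add: beta_seqs_def)

theorem mainTheorem1:
  fixes H :: "nat \<Rightarrow> 'h::complex_hilbert set"
    and M :: "nat \<Rightarrow> ('h \<Rightarrow> 'h) set"
    and I :: "'i set" and J :: "'j set"
    and R S :: "nat \<Rightarrow> (('h \<Rightarrow> 'h) \<Rightarrow> complex) set"
    and \<rho> :: "nat \<Rightarrow> 'i \<Rightarrow> ('h \<Rightarrow> 'h) \<Rightarrow> complex"
    and \<sigma> :: "nat \<Rightarrow> 'j \<Rightarrow> ('h \<Rightarrow> 'h) \<Rightarrow> complex"
    and e :: "('i, ('h \<Rightarrow> 'h) \<Rightarrow> complex) hypothesis \<Rightarrow>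
              ('j, ('h \<Rightarrow> 'h) \<Rightarrow> complex) hypothesis \<Rightarrow> ereal"
  assumes "\<And>n. commutative_vna (H n) (M n)"
    and "countable I" "I \<noteq> {}" and "countable J" "J \<noteq> {}"
    and "\<And>n. R n \<subseteq> states (H n) (M n)" "\<And>n. R n \<noteq> {}"
    and "\<And>n. S n \<subseteq> states (H n) (M n)" "\<And>n. S n \<noteq> {}"
    and "\<And>n i. i \<in> I \<Longrightarrow> \<rho> n i \<in> states (H n) (M n)"
    and "\<And>n j. j \<in> J \<Longrightarrow> \<sigma> n j \<in> states (H n) (M n)"
    and "e = stein_exponent H M \<or> e = chernoff_exponent H M \<or>
         (\<exists>r>0. e = direct_exponent H M r)"
  shows "e (Indexed I \<rho>) (Composite S) =
           (INF i\<in>I. e (Composite (\<lambda>n. {\<rho> n i})) (Composite S)) \<and>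
         e (Composite R) (Indexed J \<sigma>) =
           (INF j\<in>J. e (Composite R) (Composite (\<lambda>n. {\<sigma> n j}))) \<and>
         e (Indexed I \<rho>) (Indexed J \<sigma>) =
           (INF (i, j)\<in>I \<times> J. e (Composite (\<lambda>n. {\<rho> n i})) (Composite (\<lambda>n. {\<sigma> n j}))) \<and>
         (finite I \<longrightarrow>
           e (Indexed I \<rho>) (Composite S) = e (Composite (\<lambda>n. \<rho> n ` I)) (Composite S)) \<and>
         (finite J \<longrightarrow>
           e (Composite R) (Indexed J \<sigma>) = e (Composite R) (Composite (\<lambda>n. \<sigma> n ` J))) \<and>
         (finite I \<and> finite J \<longrightarrow>
           e (Indexed I \<rho>) (Indexed J \<sigma>) =
             e (Composite (\<lambda>n. \<rho> n ` I)) (Composite (\<lambda>n. \<sigma> n ` J)))"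
proof -
  note M = assms(1) and e = assms(12)
  note alg = commutative_vna_def[THEN iffD1, OF M, THEN conjunct1]
  note \<rho> = assms(10) and \<sigma> = assms(11)
  note INF_eq = exponent_eq_INF_members[where H = H and M = M, OF M e]
  note alpha = alpha_seqs_finite[where H = H and M = M and I = I and \<rho> = \<rho>, OF _ _ alg _ assms(3)]
    and beta = beta_seqs_finite[where H = H and M = M and J = J and \<sigma> = \<sigma>, OF _ _ alg _ assms(5)]
  \<comment> \<open>The composite side has one member; \<open>undefined\<close> is an arbitrary
    index for it, and the product with this singleton is collapsed below.\<close>
  have 1: "e (Indexed I \<rho>) (Composite S) =
      (INF (i, j)\<in>I \<times> {undefined :: 'j}. e (Composite (\<lambda>n. {\<rho> n i})) (Composite S))"
    by (rule INF_eq[where R = "\<lambda>i n. {\<rho> n i}" and S = "\<lambda>_. S"])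
      (use assms(2-11) in \<open>auto simp: has_members_Indexed has_members_Composite\<close>)
  have 2: "e (Composite R) (Indexed J \<sigma>) =
      (INF (i, j)\<in>{undefined :: 'i} \<times> J. e (Composite R) (Composite (\<lambda>n. {\<sigma> n j})))"
    by (rule INF_eq[where R = "\<lambda>_. R" and S = "\<lambda>j n. {\<sigma> n j}"])
      (use assms(2-11) in \<open>auto simp: has_members_Indexed has_members_Composite\<close>)
  have 3: "e (Indexed I \<rho>) (Indexed J \<sigma>) =
      (INF (i, j)\<in>I \<times> J. e (Composite (\<lambda>n. {\<rho> n i})) (Composite (\<lambda>n. {\<sigma> n j})))"
    by (rule INF_eq[where R = "\<lambda>i n. {\<rho> n i}" and S = "\<lambda>j n. {\<sigma> n j}"])
      (use assms(2-11) in \<open>auto simp: has_members_Indexed\<close>)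
  have "(\<lambda>(i, j). f i) ` (I \<times> {undefined :: 'j}) = f ` I"
    "(\<lambda>(i, j). g j) ` ({undefined :: 'i} \<times> J) = g ` J" for f :: "'i \<Rightarrow> ereal" and g :: "'j \<Rightarrow> ereal"
    by force+
  note 12 = 1[unfolded this] 2[unfolded this]
  have "e (Indexed I \<rho>) (Composite S) = e (Composite (\<lambda>n. \<rho> n ` I)) (Composite S)" if "finite I"
    by (rule exponent_cong[OF e]) (simp_all add: alpha[OF _ _ that \<rho>])
  moreover have "e (Composite R) (Indexed J \<sigma>) = e (Composite R) (Composite (\<lambda>n. \<sigma> n ` J))"
    if "finite J"
    by (rule exponent_cong[OF e]) (simp_all add: beta[OF _ _ that \<sigma>])
  moreover have "e (Indexed I \<rho>) (Indexed J \<sigma>) =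
      e (Composite (\<lambda>n. \<rho> n ` I)) (Composite (\<lambda>n. \<sigma> n ` J))" if "finite I" "finite J"
    by (rule exponent_cong[OF e])
      (simp_all add: alpha[OF _ _ that(1) \<rho>] beta[OF _ _ that(2) \<sigma>])
  ultimately show ?thesis
    using 12 3 by blast
qed

end
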